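(* Let $\gamma\in\{1,-1\}$, $\sigma\in(0,3/2]$, and let $a_n>0$, $b_n\in\mathbb R$ satisfy, as $n\to\infty$, $$a_n=n^\sigma(1+\alpha n^{-1}+O(n^{-2})),\qquad b_n=2\gamma n^\sigma(1+\beta n^{-1}+O(n^{-2})),$$ with $\alpha,\beta\in\mathbb R$; put $\tau=2\beta-2\alpha+\sigma$. Let one of the following three assumptions be satisfied: $1^0$ $\sigma\in(1,3/2]$ and either $\tau<0$, $\sigma<3/2$ and $\Im z\ne0$, or $\tau>0$ and $z\in\mathbb C$ is arbitrary; $2^0$ $\sigma\in(0,1)$ and either $\gamma=1$ and $z\notin[0,\infty)$, or $\gamma=-1$ and $z\notin(-\infty,0]$; $3^0$ $\sigma=1$ and either $\gamma=1$ and $z\notin[\tau,\infty)$, or $\gamma=-1$ and $z\notin(-\infty,-\tau]$. Let $f_n(z)$ be the Jost solution of the equation $a_{n-1}F_{n-1}+b_nF_n+a_nF_{n+1}=zF_n$, $n\ge1$, i.e. the solution with $$f_n(z)=(-\gamma)^nn^{-\rho}e^{i\varphi_n(\gamma z)}(1+o(1)),\qquad n\to\infty,$$ and let $g_n(z)$ be the solution of the same equation which for $n\ge n_0$ (with $n_0=n_0(z)$ sufficiently large) is given by $$g_n(z)=f_n(z)\sum_{m=n_0}^n\bigl(a_{m-1}f_{m-1}(z)f_m(z)\bigr)^{-1}.$$ Then $$g_n(z)=i\varkappa(z)(-\gamma)^{n+1}n^{-\rho}e^{-i\varphi_n(\gamma z)}(1+o(1)),\qquad n\to\infty.$$ In particular,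 $(g_n(z))\notin\ell^2(\mathbb Z_+)$ if $z\notin\operatorname{clos}\mathcal S$.
   Context: $\mathbb Z_+=\{0,1,2,\dots\}$. $\sqrt t$ is the analytic branch on $\mathbb C\setminus[0,\infty)$ with $\Im\sqrt t>0$. $\rho=\sigma/2-1/4$ if $\sigma\ge1$, $\rho=\sigma/4$ if $\sigma\le1$. For $n\ge1$ put $t_n(z)=-\tau n^{-1}+zn^{-\sigma}$. If $\sigma>1$, $\theta_n(z)=\sqrt{t_n(z)}$; if $\sigma=1$, $\theta_n(z)=\sqrt{z-\tau}\,n^{-1/2}$; if $\sigma<1$, $\theta_n(z)=\sqrt{T_n(z)}$, $T_n=t_n+\sum_{l=2}^Lp_lt_n^l$, where $L\ge1$ is a fixed integer with $(L+1/2)\sigma>1$ and the real numbers $p_2,\dots,p_L$ are determined by the requirement that, with $c_k=2(-1)^{k+1}/(2k)!$ and $P(t)=\sum_{l=2}^Lp_lt^l$, the polynomial $P(t)+\sum_{k=2}^Lc_k(P(t)+t)^k$ has no terms of degree $\le L$. $\varphi_n(z)=\sum_{m=N}^n\theta_m(z)$, where $N$ is a fixed integer, large enough (depending on the fixed $z$) that $\theta_m(\gamma z)$ is well defined for $m\ge N$. The number $\varkappa(z)$ is: $\pm\sqrt{|\tau|}$ if $\sigma>1$, $\tau<0$, $\pm\Im z\ge0$; $i\sqrt{\tau}$ if $\sigma>1$, $\tau>0$, $z\in\mathbb C$; $\sqrt z$ if $\sigma<1$, $z\in\operatorname{clos}(\mathbb C\setminus[0,\infty))$, $z\ne0$; $\sqrt{z-\tau}$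 if $\sigma=1$, $z\in\tau+\operatorname{clos}(\mathbb C\setminus[0,\infty))$, $z\ne\tau$. The set $\mathcal S$ is: $\mathbb R$ if $\sigma\in(1,3/2]$, $\tau<0$; $\emptyset$ if $\sigma\in(1,3/2]$, $\tau>0$; $\gamma(0,\infty)$ if $\sigma\in(0,1)$; $\gamma(\tau,\infty)$ if $\sigma=1$, where $\gamma(c,\infty)=\{\gamma x:x>c\}$. The Jost solution exists, and $f_n(z)\ne0$ for all large $n$; any solution given for large $n$ is extended to all $n$ by the equation.
   Formalization: The constant iϰ(z) in the asymptotics of g_n is replaced by i/(2ϰ(γz)); the printed constant is false, e.g. for γ=−1, σ>1, τ>0, z=0, where g_n is asymptotically positive but iϰ=−√τ<0. *)

theory Defs
  imports
    "HOL-Analysis.Analysis"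
    "HOL-Computational_Algebra.Polynomial"
    "HOL-Library.Landau_Symbols"
begin

definition jacobi_solution ::
    "(nat \<Rightarrow> real) \<Rightarrow> (nat \<Rightarrow> real) \<Rightarrow> complex \<Rightarrow> (nat \<Rightarrow> complex) \<Rightarrow> bool" where
  "jacobi_solution a b z F \<longleftrightarrow>
     (\<forall>n\<ge>1. of_real (a (n - 1)) * F (n - 1) + of_real (b n) * F n
               + of_real (a n) * F (n + 1) = z * F n)"

text \<open>The branch of the square root that is analytic off \<open>[0,\<infinity>)\<close> and has positive
  imaginary part there. Its value on the cut is never used.\<close>

definition bsqrt :: "complex \<Rightarrow> complex" where
  "bsqrt t = \<i> * csqrt (- t)"

lemma bsqrt_square: "(bsqrt t)\<^sup>2 = t"
  by (simp add: bsqrt_def power_mult_distrib)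

lemma Im_bsqrt_pos:
  assumes "t \<notin> \<real>\<^sub>\<ge>\<^sub>0"
  shows "Im (bsqrt t) > 0"
proof -
  have "(csqrt (- t))\<^sup>2 = - t" by simp
  moreover have "Re (csqrt (- t)) \<ge> 0"
    using csqrt_principal[of "- t"] by linarith
  moreover have "Re (csqrt (- t)) \<noteq> 0"
  proof
    assume "Re (csqrt (- t)) = 0"
    then obtain y where y: "csqrt (- t) = \<i> * of_real y"
      by (metis complex_eq add_0 of_real_0)
    have "- t = (\<i> * of_real y)\<^sup>2"
      using y by (metis power2_csqrt)
    then have "t = of_real (y\<^sup>2)"
      by (simp add: power_mult_distrib)
    with assms show False
      by (metis nonneg_Reals_of_real_iff zero_le_power2)
  qed
  ultimately show ?thesis
    by (simp add: bsqrt_def)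
qed

definition rho :: "real \<Rightarrow> real" where
  "rho \<sigma> = (if \<sigma> \<ge> 1 then \<sigma> / 2 - 1 / 4 else \<sigma> / 4)"

definition corr_poly :: "nat \<Rightarrow> (nat \<Rightarrow> real) \<Rightarrow> real poly" where
  "corr_poly L p = (\<Sum>l=2..L. monom (p l) l)"

text \<open>The requirement that determines \<open>p 2, \<dots>, p L\<close>. With \<open>T = P(t) + t\<close> it says that
  the expansion of \<open>2 - 2 cos (sqrt T)\<close>, cut off at order \<open>L\<close>, is \<open>t\<close> up to terms of
  degree above \<open>L\<close>. The values \<open>p l\<close> for other \<open>l\<close> play no role.\<close>

definition corr_coeffs :: "nat \<Rightarrow> (nat \<Rightarrow> real) \<Rightarrow> bool" where
  "corr_coeffs L p \<longleftrightarrow>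
     (\<forall>j\<le>L. coeff (corr_poly L p
        + (\<Sum>k=2..L. smult (2 * (-1) ^ (k + 1) / fact (2 * k))
                          ((corr_poly L p + monom 1 1) ^ k))) j = 0)"

definition tt :: "real \<Rightarrow> real \<Rightarrow> nat \<Rightarrow> complex \<Rightarrow> complex" where
  "tt \<sigma> \<tau> n z = - of_real (\<tau> / real n) + z * of_real (real n powr (- \<sigma>))"

definition TT :: "real \<Rightarrow> real \<Rightarrow> nat \<Rightarrow> (nat \<Rightarrow> real) \<Rightarrow> nat \<Rightarrow> complex \<Rightarrow> complex" where
  "TT \<sigma> \<tau> L p n z = tt \<sigma> \<tau> n z + (\<Sum>l=2..L. of_real (p l) * tt \<sigma> \<tau> n z ^ l)"

text \<open>The argument of the square root in \<open>\<theta>\<^sub>n(z)\<close>; \<open>\<theta>\<^sub>n(z)\<close> is well defined when it lies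
  off \<open>[0,\<infinity>)\<close>.\<close>

definition theta_arg ::
    "real \<Rightarrow> real \<Rightarrow> nat \<Rightarrow> (nat \<Rightarrow> real) \<Rightarrow> nat \<Rightarrow> complex \<Rightarrow> complex" where
  "theta_arg \<sigma> \<tau> L p n z =
     (if \<sigma> > 1 then tt \<sigma> \<tau> n z
      else if \<sigma> = 1 then z - of_real \<tau>
      else TT \<sigma> \<tau> L p n z)"

definition theta ::
    "real \<Rightarrow> real \<Rightarrow> nat \<Rightarrow> (nat \<Rightarrow> real) \<Rightarrow> nat \<Rightarrow> complex \<Rightarrow> complex" where
  "theta \<sigma> \<tau> L p n z =
     (if \<sigma> = 1 then bsqrt (theta_arg \<sigma> \<tau> L p n z) * of_real (real n powr (- 1 / 2))
      else bsqrt (theta_arg \<sigma> \<tau> L p n z))"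

definition phase ::
    "real \<Rightarrow> real \<Rightarrow> nat \<Rightarrow> (nat \<Rightarrow> real) \<Rightarrow> nat \<Rightarrow> nat \<Rightarrow> complex \<Rightarrow> complex" where
  "phase \<sigma> \<tau> L p N n z = (\<Sum>m=N..n. theta \<sigma> \<tau> L p m z)"

text \<open>Boundary values (the two values at real \<open>z\<close> for \<open>\<sigma> > 1\<close>, \<open>\<tau> < 0\<close>, and the limits
  on the cut for \<open>\<sigma> \<le> 1\<close>) are not modelled; they do not occur below.\<close>

definition varkappa :: "real \<Rightarrow> real \<Rightarrow> complex \<Rightarrow> complex" where
  "varkappa \<sigma> \<tau> z =
     (if \<sigma> > 1 then
        (if \<tau> < 0 then (if Im z \<ge> 0 then of_real (sqrt \<bar>\<tau>\<bar>) else - of_real (sqrt \<bar>\<tau>\<bar>))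
         else \<i> * of_real (sqrt \<tau>))
      else if \<sigma> = 1 then bsqrt (z - of_real \<tau>)
      else bsqrt z)"

definition spec_set :: "real \<Rightarrow> real \<Rightarrow> real \<Rightarrow> complex set" where
  "spec_set \<gamma> \<sigma> \<tau> =
     (if \<sigma> > 1 then (if \<tau> < 0 then \<real> else {})
      else if \<sigma> = 1 then {of_real (\<gamma> * x) | x. x > \<tau>}
      else {of_real (\<gamma> * x) | x. x > 0})"

text \<open>On the constant in the asymptotics of the growing solution \<open>g\<close>. The source prints
  \<open>\<i> \<kappa>(z)\<close>; this is a misprint for \<open>\<i> / (2 \<kappa>(\<gamma> z))\<close>, which is what the theorem
  states (\<open>\<kappa>\<close> being \<^const>\<open>varkappa\<close>). Up to smaller terms, \<open>\<theta>\<^sub>n(\<gamma> z)\<close> is \<open>\<kappa>(\<gamma> z)\<close> times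
  \<open>n powr (2 \<rho> - \<sigma>)\<close>, and summation by parts in the formula for \<open>g\<close> divides by
  \<open>-2 \<i> \<kappa>(\<gamma> z)\<close>. The printed constant fails already for \<open>\<gamma> = -1\<close>, \<open>\<sigma> > 1\<close>, \<open>\<tau> > 0\<close>,
  \<open>z = 0\<close>: there the leading terms of \<open>f\<close> and \<open>g\<close> are positive, but \<open>\<i> \<kappa> = - sqrt \<tau>\<close>.
  For \<open>\<gamma> = -1\<close>, \<open>\<sigma> < 1\<close>, \<open>z > 0\<close> the number \<open>\<kappa>(z)\<close> lies on the cut and is not
  even single-valued, whereas \<open>\<kappa>(\<gamma> z)\<close> is well defined in all cases considered.\<close>

end

theory Submission
  imports Defs "HOL-Real_Asymp.Real_Asymp"
begin

text \<open>
  \<^emph>\<open>Reduction to one sum.\<close> Put \<open>w = \<gamma> z\<close>, \<open>\<omega> = - \<gamma>\<close>, let \<open>\<Phi> n\<close> be the phase at \<open>w\<close>,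
  \<open>A n = \<omega>\<^sup>n n powr (- \<rho>) exp (\<i> \<Phi> n)\<close> and \<open>E n = exp (- 2 \<i> \<Phi> n)\<close>, so that \<open>f n = A n * u n\<close> with
  \<open>u \<longlonglongrightarrow> 1\<close>. In all cases \<open>\<theta> n\<close> is asymptotic to \<open>\<kappa> n powr (- \<nu>)\<close> with \<open>\<nu> = \<sigma> - 2 \<rho>\<close>. The summand
  \<open>1 / (a (m - 1) f (m - 1) f m)\<close> is therefore close to \<open>\<omega> m powr (- \<nu>) E m\<close>, and
  \<open>E m - E (m - 1)\<close> is close to \<open>- 2 \<i> \<kappa> m powr (- \<nu>) E m\<close>; the summand is \<open>Y\<close> times an increment
  of \<open>E\<close> with \<open>Y \<longlonglongrightarrow> c = \<omega> \<i> / (2 \<kappa>)\<close>. If the sums are asymptotic to \<open>c * E n\<close>, then \<open>g n\<close> is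
  asymptotic to \<open>c * A n * E n\<close>, which is the claim. Since \<open>n * Im (\<theta> n)\<close> tends to infinity,
  \<open>\<bar>E n\<bar>\<close> outgrows every power of \<open>n\<close> (lemma \<open>growth\<close>); so \<open>\<bar>g n\<bar>\<close> is unbounded, and \<open>g\<close> is not
  square summable.

  \<^emph>\<open>Summation.\<close> A discrete l'Hopital rule (\<open>smallo_of_increments\<close>) discards errors whose increments are
  small against those of \<open>M n = \<bar>E n\<bar>\<close>, which are at least \<open>2 Im (\<theta> (n + 1)) M n\<close>.

  If \<open>\<kappa>\<close> is off the real axis, then \<open>\<bar>\<theta> n\<bar>\<close> and \<open>Im (\<theta> n)\<close> are comparable. Hence \<open>\<bar>E (n + 1) - E n\<bar>\<close>
  is bounded by a multiple of the increment of \<open>M\<close>, and \<open>Y \<longlonglongrightarrow> c\<close> gives the asymptotics of the sums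
  (\<open>sum_asymp_sector\<close>).

  If \<open>\<sigma> > 1\<close> and \<open>\<tau> < 0\<close>, then \<open>\<kappa>\<close> is real, \<open>\<theta> n\<close> has size \<open>n powr (- 1 / 2)\<close>, but its imaginary part
  only the size \<open>n powr (1 / 2 - \<sigma>)\<close>: the sum oscillates, and \<open>Y n - c\<close> without a rate is too weak.
  Summation by parts moves the difference to \<open>Y\<close>, and it suffices that
  \<open>Y (n + 1) - Y n\<close> is small against \<open>Im (\<theta> n)\<close> (\<open>sum_asymp_slow\<close>). It is \<open>O(1 / n)\<close>, and
  \<open>\<sigma> < 3 / 2\<close> makes this enough. All factors of \<open>Y\<close> but \<open>u\<close> are explicit. For \<open>u\<close> the recurrence is used:
  \<open>D n = a n * A n * A (n + 1) * (u (n + 1) - u n)\<close> satisfies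
  \<open>D (n + 1) - D n = - (A (n + 1))\<^sup>2 R (n + 1) u (n + 1)\<close>, where \<open>R\<close> is the residual of the ansatz
  \<open>A\<close> in the equation. The choice of \<open>\<rho>\<close>, \<open>\<tau>\<close> and \<open>\<theta>\<close> cancels the leading terms and leaves
  \<open>R = O(n powr (- 1 / 2))\<close> (\<open>R_bigo\<close>). Summing from infinity gives \<open>D n = O(n powr (- 1 / 2) / M n)\<close>
  (\<open>D_bound\<close>), hence \<open>u (n + 1) - u n = O(1 / n)\<close>.
\<close>

section \<open>Comparison of sequences by their increments\<close>

text \<open>A discrete l'Hopital rule of Stolz-Cesaro type: summing the increments from a late index \<open>k\<close> on leaves a
  constant \<open>h k\<close>, which is negligible because \<open>M\<close> is unbounded.\<close>

lemma smallo_of_increments: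
  fixes h :: "nat \<Rightarrow> complex" and M :: "nat \<Rightarrow> real"
  assumes M: "filterlim M at_top sequentially"
    and mono: "\<forall>\<^sub>F n in sequentially. M n \<le> M (Suc n)"
    and small: "(\<lambda>n. cmod (h (Suc n) - h n)) \<in> o(\<lambda>n. M (Suc n) - M n)"
  shows "(\<lambda>n. cmod (h n)) \<in> o(M)"
proof (rule landau_o.smallI)
  fix e :: real assume e: "e > 0"
  have "\<forall>\<^sub>F n in sequentially. cmod (h (Suc n) - h n) \<le> e/2 * (M (Suc n) - M n)"
    using landau_o.smallD[OF small, of "e/2"] mono e by (auto elim: eventually_elim2)
  then obtain k where k: "\<And>n. n \<ge> k \<Longrightarrow> cmod (h (Suc n) - h n) \<le> e/2 * (M (Suc n) - M n)"
    by (auto simp: eventually_sequentially)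
  have step: "cmod (h n) \<le> cmod (h k) + e/2 * (M n - M k)" if "n \<ge> k" for n
    using that
  proof (induction n rule: dec_induct)
    case (step n)
    have "cmod (h (Suc n)) \<le> cmod (h n) + cmod (h (Suc n) - h n)"
      using norm_triangle_ineq[of "h n" "h (Suc n) - h n"] by simp
    with step.IH k[OF step.hyps(1)] show ?case
      unfolding right_diff_distrib by linarith
  qed simp
  have "\<forall>\<^sub>F n in sequentially. M n \<ge> max 0 (2/e * (cmod (h k) - e/2 * M k))"
    using M unfolding filterlim_at_top by blast
  then show "\<forall>\<^sub>F n in sequentially. norm (cmod (h n)) \<le> e * norm (M n)"
    using eventually_ge_at_top[of k]
  proof eventually_elim
    case (elim n)
    have "cmod (h k) - e/2 * M k \<le> e/2 * M n"
      using elim(1) e by (simp add: field_simps)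
    with step[OF elim(2)] elim(1) show ?case
      unfolding right_diff_distrib by simp
  qed
qed

text \<open>The counterpart for sequences that tend to zero: here the increments are summed from infinity.\<close>

lemma norm_le_of_increments:
  fixes d :: "nat \<Rightarrow> complex" and X :: "nat \<Rightarrow> real"
  assumes d: "d \<longlonglongrightarrow> 0" and X: "X \<longlonglongrightarrow> 0"
    and incr: "\<And>n. n \<ge> k \<Longrightarrow> cmod (d (Suc n) - d n) \<le> X n - X (Suc n)"
    and n: "n \<ge> k"
  shows "cmod (d n) \<le> X n"
proof -
  have step: "cmod (d m - d n) \<le> X n - X m" if "m \<ge> n" for m
    using that
  proof (induction m rule: dec_induct)
    case (step m)
    have "cmod (d (Suc m) - d n) \<le> cmod (d m - d n) + cmod (d (Suc m) - d m)"
      using norm_triangle_ineq[of "d m - d n" "d (Suc m) - d m"] by simp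
    with step.IH incr[of m] step.hyps n show ?case by simp
  qed simp
  have "(\<lambda>m. cmod (d m - d n)) \<longlonglongrightarrow> cmod (0 - d n)"
    by (intro tendsto_intros d)
  moreover have "(\<lambda>m. X n - X m) \<longlonglongrightarrow> X n - 0"
    by (intro tendsto_intros X)
  ultimately have "cmod (0 - d n) \<le> X n - 0"
    by (rule LIMSEQ_le) (use step in blast)
  then show ?thesis by simp
qed

section \<open>Expansions\<close>

lemma exp_taylor_bigo:
  fixes v :: "nat \<Rightarrow> complex"
  assumes "v \<longlonglongrightarrow> 0"
  shows "(\<lambda>n. exp (v n) - (\<Sum>k\<le>K. v n ^ k / fact k)) \<in> O(\<lambda>n. v n ^ Suc K)"
proof (rule bigoI[of _ "exp 1 / fact K"])
  have "\<forall>\<^sub>F n in sequentially. cmod (v n) < 1"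
    using tendsto_norm[OF assms] by (rule order_tendstoD(2)) simp
  then show "\<forall>\<^sub>F n in sequentially. cmod (exp (v n) - (\<Sum>k\<le>K. v n ^ k / fact k))
               \<le> exp 1 / fact K * cmod (v n ^ Suc K)"
  proof eventually_elim
    case (elim n)
    have "cmod (exp (v n) - (\<Sum>k\<le>K. v n ^ k / fact k))
            \<le> exp (cmod (v n)) * (cmod (v n) ^ Suc K) / fact K"
      by (rule Taylor_exp_field)
    also have "\<dots> \<le> exp 1 * (cmod (v n) ^ Suc K) / fact K"
      using elim by (intro divide_right_mono mult_right_mono) auto
    finally show ?case
      by (simp only: norm_power times_divide_eq_left)
  qed
qed

lemma ratio_tendsto_1:
  fixes r :: "nat \<Rightarrow> real"
  assumes "(\<lambda>n. r n - (1 + \<alpha> / real n)) \<in> O(\<lambda>n. 1 / real n ^ 2)"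
  shows "r \<longlonglongrightarrow> 1"
proof -
  have "(\<lambda>n. 1 / real n ^ 2) \<in> o(\<lambda>_. 1)"
    by real_asymp
  from smalloD_tendsto[OF landau_o.big_small_trans[OF assms this]]
  have "(\<lambda>n. r n - (1 + \<alpha> / real n)) \<longlonglongrightarrow> 0"
    by simp
  moreover have "(\<lambda>n. 1 + \<alpha> / real n) \<longlonglongrightarrow> 1"
    by real_asymp
  ultimately have "(\<lambda>n. r n - (1 + \<alpha> / real n) + (1 + \<alpha> / real n)) \<longlonglongrightarrow> 0 + 1"
    by (rule tendsto_add)
  then show ?thesis by simp
qed

section \<open>The second solution behind a decaying exponential ansatz\<close>

text \<open>The common frame: \<open>\<nu> = \<sigma> - 2 \<rho>\<close> is the decay exponent of \<open>\<theta>\<close>. What follows from these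
  assumptions rests on the leading asymptotics of \<open>f\<close>; the recurrence comes in with the residual below.\<close>

locale wkb =
  fixes \<omega> \<rho> \<nu> :: real and a :: "nat \<Rightarrow> real" and \<theta> :: "nat \<Rightarrow> complex"
    and \<kappa> :: complex and N :: nat and f :: "nat \<Rightarrow> complex"
  assumes \<omega>_sq: "\<omega> * \<omega> = 1"
    and a_pos: "\<And>n. a n > 0"
    and a_asymp: "(\<lambda>n. a n * real n powr (- (2 * \<rho> + \<nu>))) \<longlonglongrightarrow> 1"
    and \<nu>_pos: "\<nu> > 0"
    and \<kappa>_nz: "\<kappa> \<noteq> 0"
    and \<theta>_asymp: "(\<lambda>n. of_real (real n powr \<nu>) * \<theta> n) \<longlonglongrightarrow> \<kappa>"
    and Im_\<theta>: "filterlim (\<lambda>n. real n * Im (\<theta> n)) at_top sequentially"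
    and f_asymp: "f \<sim>[sequentially] (\<lambda>n. of_real \<omega> ^ n * of_real (real n powr (- \<rho>))
                    * exp (\<i> * (\<Sum>m=N..n. \<theta> m)))"
begin

definition \<Phi> :: "nat \<Rightarrow> complex" where "\<Phi> n = (\<Sum>m=N..n. \<theta> m)"

definition A :: "nat \<Rightarrow> complex" where
  "A n = of_real \<omega> ^ n * of_real (real n powr (- \<rho>)) * exp (\<i> * \<Phi> n)"

definition u :: "nat \<Rightarrow> complex" where "u n = f n / A n"

text \<open>Up to a power of \<open>n\<close>, \<open>E n\<close> is \<open>1 / (A n)\<^sup>2\<close>: the sums in the second solution grow like it.\<close>

definition E :: "nat \<Rightarrow> complex" where "E n = exp (- 2 * \<i> * \<Phi> n)"

definition M :: "nat \<Rightarrow> real" where "M n = exp (2 * Im (\<Phi> n))"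

definition summand :: "nat \<Rightarrow> complex" where
  "summand n = inverse (of_real (a (n - 1)) * f (n - 1) * f n)"

definition Q :: "nat \<Rightarrow> real" where "Q n = a n * (real n * (real n + 1)) powr (- \<rho>)"

text \<open>\<open>Y n\<close> is the quotient of \<open>summand (Suc n)\<close> by \<open>E (Suc n) - E n\<close>, written in a form that shows its
  limit \<open>c\<close>.\<close>

definition Y :: "nat \<Rightarrow> complex" where
  "Y n = of_real \<omega> * \<i> / (2 * (of_real (Q n) * sin (\<theta> (Suc n))) * (u n * u (Suc n)))"

definition c :: complex where "c = of_real \<omega> * \<i> / (2 * \<kappa>)"

lemma \<Phi>_Suc: "Suc n \<ge> N \<Longrightarrow> \<Phi> (Suc n) = \<Phi> n + \<theta> (Suc n)"
  by (simp add: \<Phi>_def)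

lemma \<omega>_nz: "\<omega> \<noteq> 0"
  using \<omega>_sq by auto

lemma A_nz: "n \<ge> 1 \<Longrightarrow> A n \<noteq> 0"
  using \<omega>_nz by (simp add: A_def)

lemma M_pos [simp]: "M n > 0"
  by (simp add: M_def)

lemma norm_E: "cmod (E n) = M n"
  by (simp add: E_def M_def)

lemma E_nz [simp]: "E n \<noteq> 0"
  by (simp add: E_def)

lemma E_Suc: "Suc n \<ge> N \<Longrightarrow> E (Suc n) = E n * exp (- 2 * \<i> * \<theta> (Suc n))"
  by (simp add: E_def \<Phi>_Suc ring_distribs flip: exp_add)

lemma M_Suc: "Suc n \<ge> N \<Longrightarrow> M (Suc n) = M n * exp (2 * Im (\<theta> (Suc n)))"
  by (simp add: M_def \<Phi>_Suc ring_distribs flip: exp_add)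

text \<open>The imaginary part of \<open>\<theta>\<close> controls the growth of \<open>M\<close>; together with \<open>smallo_of_increments\<close> this makes
  \<open>M n * Im (\<theta> (Suc n))\<close> the yardstick for admissible errors.\<close>

lemma M_increment: "Suc n \<ge> N \<Longrightarrow> M n * (2 * Im (\<theta> (Suc n))) \<le> M (Suc n) - M n"
proof -
  assume "Suc n \<ge> N"
  have "M n * (1 + 2 * Im (\<theta> (Suc n))) \<le> M n * exp (2 * Im (\<theta> (Suc n)))"
    by (intro mult_left_mono exp_ge_add_one_self less_imp_le M_pos)
  with \<open>Suc n \<ge> N\<close> show ?thesis
    by (simp add: M_Suc ring_distribs)
qed

lemma ev_N: "\<forall>\<^sub>F n in sequentially. n \<ge> 1 \<and> n \<ge> N"
  using eventually_ge_at_top[of "max 1 N"] by simp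

lemma ev_Im_\<theta>: "\<forall>\<^sub>F n in sequentially. Im (\<theta> (Suc n)) > 0"
proof -
  have "\<forall>\<^sub>F n in sequentially. real n * Im (\<theta> n) > 0"
    using Im_\<theta> by (simp add: filterlim_at_top_dense)
  then have "\<forall>\<^sub>F n in sequentially. Im (\<theta> n) > 0"
    by eventually_elim (simp add: zero_less_mult_iff)
  then show ?thesis
    by (subst eventually_sequentially_Suc)
qed

lemma \<theta>_tendsto_0: "\<theta> \<longlonglongrightarrow> 0"
proof -
  have "(\<lambda>n. real n powr (-\<nu>)) \<longlonglongrightarrow> 0"
    using \<nu>_pos by real_asymp
  then have "(\<lambda>n. of_real (real n powr (-\<nu>)) * (of_real (real n powr \<nu>) * \<theta> n)) \<longlonglongrightarrow> of_real 0 * \<kappa>"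
    by (intro tendsto_intros \<theta>_asymp)
  then have "(\<lambda>n. of_real (real n powr (-\<nu>)) * (of_real (real n powr \<nu>) * \<theta> n)) \<longlonglongrightarrow> 0"
    by simp
  moreover have "\<forall>\<^sub>F n in sequentially. of_real (real n powr (-\<nu>)) * (of_real (real n powr \<nu>) * \<theta> n) = \<theta> n"
    using eventually_gt_at_top[of 0]
    by eventually_elim (simp add: powr_minus flip: mult.assoc of_real_mult)
  ultimately show ?thesis
    by (rule Lim_transform_eventually)
qed

lemma u_tendsto: "u \<longlonglongrightarrow> 1"
proof -
  have "(\<lambda>n. if f n = 0 \<and> A n = 0 then 1 else f n / A n) \<longlonglongrightarrow> 1"
    using f_asymp unfolding A_def \<Phi>_def asymp_equiv_def .
  moreover have "\<forall>\<^sub>F n in sequentially. (if f n = 0 \<and> A n = 0 then 1 else f n / A n) = u n"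
    using ev_N by eventually_elim (simp add: A_nz u_def)
  ultimately show ?thesis
    by (rule Lim_transform_eventually)
qed

text \<open>Eventually \<open>Im (\<theta> n) \<ge> K / n\<close> for any given \<open>K\<close>, so \<open>2 * Im (\<Phi> n)\<close> increases faster than any multiple of
  \<open>ln n\<close>.\<close>

lemma growth: "filterlim (\<lambda>n. real n powr (-k) * M n) at_top sequentially"
proof -
  define h where "h n = 2 * Im (\<Phi> n) - (k + 1) * ln (real n)" for n
  (* K bounds k + 1 also for negative k; the factor 2 in the definition of M pays for 1 / n \<le> 2 / (n + 1). *)
  define K where "K = \<bar>k\<bar> + 1"
  have "\<forall>\<^sub>F n in sequentially. real n * Im (\<theta> n) \<ge> K"
    using Im_\<theta> by (simp add: filterlim_at_top)
  then have "\<forall>\<^sub>F n in sequentially. real (Suc n) * Im (\<theta> (Suc n)) \<ge> K"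
    by (subst eventually_sequentially_Suc)
  then have "\<forall>\<^sub>F n in sequentially. h n \<le> h (Suc n)"
    using ev_N
  proof eventually_elim
    case (elim n)
    have "ln (real (Suc n)) - ln (real n) = ln (1 + 1 / real n)"
      using elim ln_divide_pos[of "real (Suc n)" "real n"] by (simp add: add_divide_distrib add.commute)
    also have "\<dots> \<le> 1 / real n"
      by (rule ln_add_one_self_le_self) simp
    also have "\<dots> \<le> 2 / real (Suc n)"
      using elim by (simp add: field_simps)
    finally have "K * (ln (real (Suc n)) - ln (real n)) \<le> K * (2 / real (Suc n))"
      by (rule mult_left_mono) (simp add: K_def)
    also have "\<dots> \<le> 2 * Im (\<theta> (Suc n))"
      using elim by (simp add: field_simps)
    finally have 1: "K * (ln (real (Suc n)) - ln (real n)) \<le> 2 * Im (\<theta> (Suc n))" .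
    have "(k + 1) * (ln (real (Suc n)) - ln (real n)) \<le> K * (ln (real (Suc n)) - ln (real n))"
      using elim by (intro mult_right_mono) (auto simp: K_def)
    with 1 elim show ?case
      by (simp add: h_def \<Phi>_Suc algebra_simps)
  qed
  then obtain n1 where n1: "\<And>n. n \<ge> n1 \<Longrightarrow> h n \<le> h (Suc n)"
    by (auto simp: eventually_sequentially)
  have h: "h n1 \<le> h n" if "n \<ge> n1" for n
    using that by (induction n rule: dec_induct) (auto intro: order_trans n1)
  have "filterlim (\<lambda>n. exp (h n1) * real n) at_top sequentially"
    by real_asymp
  then show ?thesis
  proof (rule filterlim_at_top_mono)
    show "\<forall>\<^sub>F n in sequentially. exp (h n1) * real n \<le> real n powr (-k) * M n"
      using eventually_ge_at_top[of "max 1 n1"]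
    proof eventually_elim
      case (elim n)
      have "real n powr (-k) * M n = exp (h n) * real n"
        using elim by (simp add: M_def h_def powr_def exp_diff exp_minus field_simps exp_add)
      then show ?case using h[of n] elim by simp
    qed
  qed
qed

lemma M_at_top: "filterlim M at_top sequentially"
proof -
  have "\<forall>\<^sub>F n in sequentially. real n powr (-0) * M n = M n"
    using eventually_gt_at_top[of 0] by eventually_elim simp
  from filterlim_cong[OF refl refl this] growth[of 0] show ?thesis
    by blast
qed

lemma ev_M_mono: "\<forall>\<^sub>F n in sequentially. M n \<le> M (Suc n)"
  using ev_Im_\<theta> ev_N
proof eventually_elim
  case (elim n)
  have "0 \<le> M n * (2 * Im (\<theta> (Suc n)))"
    using elim by (simp add: less_imp_le)
  also have "\<dots> \<le> M (Suc n) - M n"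
    using elim by (intro M_increment) simp
  finally show ?case by simp
qed

lemma M_increment_bigo:
  "(\<lambda>n. M n * Im (\<theta> (Suc n))) \<in> O(\<lambda>n. M (Suc n) - M n)"
proof (rule bigoI[of _ 1])
  show "\<forall>\<^sub>F n in sequentially. norm (M n * Im (\<theta> (Suc n))) \<le> 1 * norm (M (Suc n) - M n)"
    using ev_Im_\<theta> ev_N
  proof eventually_elim
    case (elim n)
    have "0 \<le> M n * Im (\<theta> (Suc n))"
      using elim by (simp add: less_imp_le)
    with M_increment[of n] elim show ?case by simp
  qed
qed

lemma ev_\<theta>_nz: "\<forall>\<^sub>F n in sequentially. \<theta> (Suc n) \<noteq> 0"
  using ev_Im_\<theta> by eventually_elim auto

lemma \<theta>_Suc_tendsto_0: "(\<lambda>n. \<theta> (Suc n)) \<longlonglongrightarrow> 0"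
  by (rule LIMSEQ_Suc[OF \<theta>_tendsto_0])

lemma sin_\<theta>_ratio: "(\<lambda>n. sin (\<theta> (Suc n)) / \<theta> (Suc n)) \<longlonglongrightarrow> 1"
proof -
  have "((\<lambda>z::complex. sin z / z) \<longlongrightarrow> 1) (at 0)"
    using DERIV_sin[of "0::complex"] by (simp add: has_field_derivative_iff)
  moreover have "filterlim (\<lambda>n. \<theta> (Suc n)) (at 0) sequentially"
    using \<theta>_Suc_tendsto_0 ev_\<theta>_nz by (simp add: filterlim_at)
  ultimately show ?thesis
    by (rule filterlim_compose)
qed

lemma Q_scaled: "(\<lambda>n. Q n * real (Suc n) powr (-\<nu>)) \<longlonglongrightarrow> 1"
proof -
  have "(\<lambda>n. (real n * (real n + 1)) powr (-\<rho>) * real n powr (2*\<rho>+\<nu>) * (real n + 1) powr (-\<nu>)) \<longlonglongrightarrow> 1"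
    by real_asymp
  then have "(\<lambda>n. (a n * real n powr (- (2 * \<rho> + \<nu>))) *
     ((real n * (real n + 1)) powr (-\<rho>) * real n powr (2*\<rho>+\<nu>) * (real n + 1) powr (-\<nu>))) \<longlonglongrightarrow> 1 * 1"
    by (intro tendsto_mult a_asymp)
  then have "(\<lambda>n. (a n * real n powr (- (2 * \<rho> + \<nu>))) *
     ((real n * (real n + 1)) powr (-\<rho>) * real n powr (2*\<rho>+\<nu>) * (real n + 1) powr (-\<nu>))) \<longlonglongrightarrow> 1"
    by simp
  then show ?thesis
  proof (rule Lim_transform_eventually)
    show "\<forall>\<^sub>F n in sequentially. (a n * real n powr (- (2 * \<rho> + \<nu>))) *
     ((real n * (real n + 1)) powr (-\<rho>) * real n powr (2*\<rho>+\<nu>) * (real n + 1) powr (-\<nu>))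
       = Q n * real (Suc n) powr (-\<nu>)"
      using eventually_gt_at_top[of 0]
    proof eventually_elim
      case (elim n)
      have "real n powr (- (2 * \<rho> + \<nu>)) * real n powr (2*\<rho>+\<nu>) = 1"
        using elim by (simp flip: powr_add)
      then show ?case
        by (simp add: Q_def algebra_simps) 
    qed
  qed
qed

lemma Q_sin_tendsto: "(\<lambda>n. of_real (Q n) * sin (\<theta> (Suc n))) \<longlonglongrightarrow> \<kappa>"
proof -
  have "(\<lambda>n. of_real (Q n * real (Suc n) powr (-\<nu>)) * (of_real (real (Suc n) powr \<nu>) * \<theta> (Suc n))
         * (sin (\<theta> (Suc n)) / \<theta> (Suc n))) \<longlonglongrightarrow> of_real 1 * \<kappa> * 1"
    by (intro tendsto_mult tendsto_of_real Q_scaled sin_\<theta>_ratio LIMSEQ_Suc[OF \<theta>_asymp])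
  then have "(\<lambda>n. of_real (Q n * real (Suc n) powr (-\<nu>)) * (of_real (real (Suc n) powr \<nu>) * \<theta> (Suc n))
         * (sin (\<theta> (Suc n)) / \<theta> (Suc n))) \<longlonglongrightarrow> \<kappa>"
    by simp
  then show ?thesis
  proof (rule Lim_transform_eventually)
    show "\<forall>\<^sub>F n in sequentially. of_real (Q n * real (Suc n) powr (-\<nu>)) * (of_real (real (Suc n) powr \<nu>) * \<theta> (Suc n))
         * (sin (\<theta> (Suc n)) / \<theta> (Suc n)) = of_real (Q n) * sin (\<theta> (Suc n))"
      using ev_\<theta>_nz
      by eventually_elim (simp add: powr_minus field_simps del: of_nat_Suc)
  qed
qed

lemma c_nz: "c \<noteq> 0"
  using \<omega>_nz \<kappa>_nz by (simp add: c_def)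

lemma Y_tendsto: "Y \<longlonglongrightarrow> c"
proof -
  have "(\<lambda>n. of_real \<omega> * \<i> / (2 * (of_real (Q n) * sin (\<theta> (Suc n))) * (u n * u (Suc n))))
     \<longlonglongrightarrow> of_real \<omega> * \<i> / (2 * \<kappa> * (1 * 1))"
    by (intro tendsto_intros Q_sin_tendsto u_tendsto LIMSEQ_Suc[OF u_tendsto]) (use \<kappa>_nz in auto)
  then show ?thesis
    by (simp add: c_def Y_def[abs_def])
qed

lemma \<omega>_power_sq: "complex_of_real \<omega> ^ n * complex_of_real \<omega> ^ n = 1"
  using \<omega>_sq by (simp flip: power_mult_distrib of_real_mult)

lemma a_A_A:
  assumes "n \<ge> N"
  shows "of_real (a n) * (A n * A (Suc n)) = of_real \<omega> * of_real (Q n) * exp (\<i> * \<theta> (Suc n)) / E n"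
proof -
  have "A n * A (Suc n) = (of_real \<omega> ^ n * of_real \<omega> ^ n) * of_real \<omega> *
       of_real (real n powr (-\<rho>) * real (Suc n) powr (-\<rho>)) * (exp (\<i> * \<Phi> n) * exp (\<i> * \<Phi> (Suc n)))"
    by (simp add: A_def algebra_simps)
  also have "exp (\<i> * \<Phi> n) * exp (\<i> * \<Phi> (Suc n)) = exp (\<i> * \<theta> (Suc n)) / E n"
    using assms by (simp add: \<Phi>_Suc E_def ring_distribs exp_minus field_simps flip: exp_add)
  also have "real n powr (-\<rho>) * real (Suc n) powr (-\<rho>) = (real n * (real n + 1)) powr (-\<rho>)"
    by (simp add: powr_mult add.commute)
  finally show ?thesis
    by (simp add: \<omega>_power_sq Q_def)
qed

lemma summand_eq: "\<forall>\<^sub>F n in sequentially. summand (Suc n) = Y n * (E (Suc n) - E n)"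
proof -
  have "\<forall>\<^sub>F n in sequentially. of_real (Q n) * sin (\<theta> (Suc n)) \<noteq> 0"
    by (rule tendsto_imp_eventually_ne[OF Q_sin_tendsto \<kappa>_nz])
  then show ?thesis using ev_N
  proof eventually_elim
    case (elim n)
    define e where "e = exp (\<i> * \<theta> (Suc n))"
    have f: "f n = A n * u n" "f (Suc n) = A (Suc n) * u (Suc n)"
      using A_nz elim by (simp_all add: u_def)
    define s where "s = e - 1 / e"
    have sn: "sin (\<theta> (Suc n)) = s / (2 * \<i>)"
      by (simp add: s_def e_def sin_exp_eq exp_minus field_simps)
    have e0: "e \<noteq> 0" by (simp add: e_def)
    have s0: "s \<noteq> 0"
      using elim by (simp add: sn)
    have s_e: "1 / (e * e) - 1 = - (s / e)"
      using e0 by (simp add: s_def field_simps)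
    have AA: "of_real (a n) * (A n * A (Suc n)) = of_real \<omega> * of_real (Q n) * e / E n"
      unfolding e_def using elim by (intro a_A_A) simp
    have "summand (Suc n) = 1 / (of_real (a n) * (A n * A (Suc n)) * (u n * u (Suc n)))"
      by (simp add: summand_def f divide_inverse mult_ac)
    also have "\<dots> = of_real \<omega> * E n / (of_real (Q n) * e * (u n * u (Suc n)))"
    proof -
      have "1 / complex_of_real \<omega> = of_real \<omega>"
        using \<omega>_sq \<omega>_nz by (simp add: field_simps flip: of_real_mult)
      then have "of_real \<omega> * E n / (of_real (Q n) * e * (u n * u (Suc n)))
          = 1 / of_real \<omega> * E n / (of_real (Q n) * e * (u n * u (Suc n)))"
        by (simp only:)
      then show ?thesis
        unfolding AA by simp
    qed
    also have "\<dots> = Y n * (E n * (1 / (e * e) - 1))"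
      unfolding s_e Y_def sn using e0 s0 by (simp add: field_simps)
    also have "E n * (1 / (e * e) - 1) = E (Suc n) - E n"
      using elim by (simp add: E_Suc e_def algebra_simps exp_minus flip: exp_add) (simp add: field_simps)
    finally show ?case .
  qed
qed

text \<open>The sums may be compared with any \<open>G\<close> that behaves like \<open>c * E\<close>: the two cases differ in the choice of
  \<open>G\<close>.\<close>

lemma sum_asymp:
  assumes G: "(\<lambda>n. G n / E n) \<longlonglongrightarrow> c"
    and small: "(\<lambda>n. cmod (summand (Suc n) - (G (Suc n) - G n))) \<in> o(\<lambda>n. M n * Im (\<theta> (Suc n)))"
  shows "(\<lambda>n. (\<Sum>m=n0..n. summand m) / E n) \<longlonglongrightarrow> c"
proof -
  define h where "h n = (\<Sum>m=n0..n. summand m) - G n" for n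
  have "(\<lambda>n. cmod (h (Suc n) - h n)) \<in> o(\<lambda>n. M n * Im (\<theta> (Suc n)))"
  proof (subst landau_o.small.in_cong)
    show "\<forall>\<^sub>F n in sequentially. cmod (h (Suc n) - h n) = cmod (summand (Suc n) - (G (Suc n) - G n))"
      using eventually_ge_at_top[of n0]
      by eventually_elim (simp add: h_def algebra_simps)
  qed (rule small)
  then have "(\<lambda>n. cmod (h (Suc n) - h n)) \<in> o(\<lambda>n. M (Suc n) - M n)"
    by (rule landau_o.small_big_trans[OF _ M_increment_bigo])
  then have "(\<lambda>n. cmod (h n)) \<in> o(M)"
    by (rule smallo_of_increments[OF M_at_top ev_M_mono])
  then have "(\<lambda>n. cmod (h n) / M n) \<longlonglongrightarrow> 0"
    by (rule smalloD_tendsto)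
  then have "(\<lambda>n. h n / E n) \<longlonglongrightarrow> 0"
    by (subst tendsto_norm_zero_iff[symmetric]) (simp add: norm_divide norm_E)
  then have "(\<lambda>n. h n / E n + G n / E n) \<longlonglongrightarrow> 0 + c"
    by (intro tendsto_add G)
  then show ?thesis
    by (simp add: h_def diff_divide_distrib)
qed

text \<open>The square of the modulus of \<open>c * A n * E n\<close> is a constant times \<open>n powr (- 2 * \<rho>) * M n\<close>, so that
  \<open>growth\<close> excludes square summability.\<close>

lemma second_solution:
  assumes S: "(\<lambda>n. (\<Sum>m=n0..n. summand m) / E n) \<longlonglongrightarrow> c"
    and g: "\<And>n. n \<ge> n0 \<Longrightarrow> g n = f n * (\<Sum>m=n0..n. summand m)"
  shows "g \<sim>[sequentially] (\<lambda>n. c * of_real \<omega> ^ n * of_real (real n powr (- \<rho>)) * exp (- \<i> * \<Phi> n))"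
    and "\<not> summable (\<lambda>n. (cmod (g n))\<^sup>2)"
proof -
  define H where "H n = c * of_real \<omega> ^ n * of_real (real n powr (- \<rho>)) * exp (- \<i> * \<Phi> n)" for n
  have H: "H n = c * A n * E n" for n
    by (simp add: H_def A_def E_def algebra_simps flip: exp_add)
  have H_nz: "H n \<noteq> 0" if "n \<ge> 1" for n
    using that c_nz A_nz by (simp add: H)
  have "(\<lambda>n. u n * ((\<Sum>m=n0..n. summand m) / E n) / c) \<longlonglongrightarrow> 1 * c / c"
    by (intro tendsto_intros u_tendsto S c_nz)
  then have "(\<lambda>n. u n * ((\<Sum>m=n0..n. summand m) / E n) / c) \<longlonglongrightarrow> 1"
    using c_nz by simp
  moreover have "\<forall>\<^sub>F n in sequentially. u n * ((\<Sum>m=n0..n. summand m) / E n) / c = g n / H n"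
    using ev_N eventually_ge_at_top[of n0]
    by eventually_elim (simp add: g u_def H)
  ultimately have lim: "(\<lambda>n. g n / H n) \<longlonglongrightarrow> 1"
    by (rule Lim_transform_eventually)
  have "g \<sim>[sequentially] H"
    by (rule asymp_equivI'[OF lim])
  then show "g \<sim>[sequentially] (\<lambda>n. c * of_real \<omega> ^ n * of_real (real n powr (- \<rho>)) * exp (- \<i> * \<Phi> n))"
    unfolding H_def .
  have w1: "\<bar>\<omega>\<bar> = 1"
    using \<omega>_sq by (metis abs_mult_self_eq abs_one abs_square_eq_1 power2_eq_square)
  have normH: "(cmod (H n))\<^sup>2 = (cmod c)\<^sup>2 * (real n powr (- (2 * \<rho>)) * M n)" for n
    by (simp add: H_def M_def norm_mult norm_power w1 power_mult_distrib powr_power flip: exp_of_nat_mult)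
       (simp add: power2_eq_square algebra_simps flip: powr_add)
  have "filterlim (\<lambda>n. (cmod (H n))\<^sup>2) at_top sequentially"
    unfolding normH using c_nz
    by (intro filterlim_tendsto_pos_mult_at_top[OF tendsto_const _ growth]) simp
  then have "filterlim (\<lambda>n. (cmod (g n / H n))\<^sup>2 * (cmod (H n))\<^sup>2) at_top sequentially"
    by (intro filterlim_tendsto_pos_mult_at_top[of _ "(cmod 1)\<^sup>2"] tendsto_intros lim) auto
  moreover have "\<forall>\<^sub>F n in sequentially. (cmod (g n / H n))\<^sup>2 * (cmod (H n))\<^sup>2 = (cmod (g n))\<^sup>2"
    using ev_N by eventually_elim (simp add: norm_divide power_divide H_nz)
  from filterlim_cong[OF refl refl this]
  have "filterlim (\<lambda>n. (cmod (g n / H n))\<^sup>2 * (cmod (H n))\<^sup>2) at_top sequentially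
    \<longleftrightarrow> filterlim (\<lambda>n. (cmod (g n))\<^sup>2) at_top sequentially" .
  ultimately have top: "filterlim (\<lambda>n. (cmod (g n))\<^sup>2) at_top sequentially"
    by blast
  show "\<not> summable (\<lambda>n. (cmod (g n))\<^sup>2)"
    using summable_LIMSEQ_zero top not_tendsto_and_filterlim_at_infinity
      filterlim_at_top_imp_at_infinity sequentially_bot by blast
qed

text \<open>Comparison with \<open>G = c * E\<close>. Since \<open>\<bar>\<theta>\<bar>\<close> is bounded by a multiple of \<open>Im \<theta>\<close>, the increments of \<open>E\<close> are
  bounded by the yardstick, and the factor \<open>Y n - c\<close> makes the error small.\<close>

lemma sum_asymp_sector:
  assumes sector: "\<theta> \<in> O(\<lambda>n. of_real (Im (\<theta> n)))"
  shows "(\<lambda>n. (\<Sum>m=n0..n. summand m) / E n) \<longlonglongrightarrow> c"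
proof (rule sum_asymp)
  show "(\<lambda>n. c * E n / E n) \<longlonglongrightarrow> c" by simp
  have "(\<lambda>n. - 2 * \<i> * \<theta> (Suc n)) \<longlonglongrightarrow> - 2 * \<i> * 0"
    by (intro tendsto_intros \<theta>_Suc_tendsto_0)
  then have "(\<lambda>n. - 2 * \<i> * \<theta> (Suc n)) \<longlonglongrightarrow> 0"
    by simp
  from exp_taylor_bigo[OF this, of 0]
  have "(\<lambda>n. exp (- 2 * \<i> * \<theta> (Suc n)) - 1) \<in> O(\<lambda>n. \<theta> (Suc n))"
    by simp
  also have "(\<lambda>n. \<theta> (Suc n)) \<in> O(\<lambda>n. of_real (Im (\<theta> (Suc n))))"
    by (rule landau_o.big.compose[OF sector filterlim_Suc])
  finally have "(\<lambda>n. cmod (exp (- 2 * \<i> * \<theta> (Suc n)) - 1)) \<in> O(\<lambda>n. cmod (of_real (Im (\<theta> (Suc n)))))"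
    by (subst landau_o.big.norm_iff)
  then have "(\<lambda>n. cmod (exp (- 2 * \<i> * \<theta> (Suc n)) - 1)) \<in> O(\<lambda>n. Im (\<theta> (Suc n)))"
    by simp
  then have dE: "(\<lambda>n. M n * cmod (exp (- 2 * \<i> * \<theta> (Suc n)) - 1)) \<in> O(\<lambda>n. M n * Im (\<theta> (Suc n)))"
    by (rule landau_o.big.mult_left)
  have "(\<lambda>n. cmod (Y n - c)) \<longlonglongrightarrow> cmod (c - c)"
    by (intro tendsto_intros Y_tendsto)
  then have "(\<lambda>n. cmod (Y n - c)) \<in> o(\<lambda>_. 1)"
    by (intro smalloI_tendsto) auto
  from landau_o.small_big_mult[OF this dE]
  have "(\<lambda>n. cmod (Y n - c) * (M n * cmod (exp (- 2 * \<i> * \<theta> (Suc n)) - 1)))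
          \<in> o(\<lambda>n. M n * Im (\<theta> (Suc n)))"
    by simp
  also have "?this \<longleftrightarrow> (\<lambda>n. cmod (summand (Suc n) - (c * E (Suc n) - c * E n))) \<in> o(\<lambda>n. M n * Im (\<theta> (Suc n)))"
  proof (rule landau_o.small.in_cong)
    show "\<forall>\<^sub>F n in sequentially. cmod (Y n - c) * (M n * cmod (exp (- 2 * \<i> * \<theta> (Suc n)) - 1))
            = cmod (summand (Suc n) - (c * E (Suc n) - c * E n))"
      using summand_eq ev_N
    proof eventually_elim
      case (elim n)
      have "summand (Suc n) - (c * E (Suc n) - c * E n) = (Y n - c) * (E n * (exp (- 2 * \<i> * \<theta> (Suc n)) - 1))"
        using elim by (simp add: E_Suc algebra_simps)
      then show ?case
        by (simp add: norm_mult norm_E del: mult_minus_left)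
    qed
  qed
  finally show "(\<lambda>n. cmod (summand (Suc n) - (c * E (Suc n) - c * E n))) \<in> o(\<lambda>n. M n * Im (\<theta> (Suc n)))" .
qed

text \<open>Comparison with \<open>G = Y * E\<close>, which is summation by parts: the error
  \<open>(Y (Suc n) - Y n) * E (Suc n)\<close> has no factor \<open>E (Suc n) - E n\<close>.\<close>

lemma sum_asymp_slow:
  assumes slow: "(\<lambda>n. cmod (Y (Suc n) - Y n)) \<in> o(\<lambda>n. Im (\<theta> (Suc n)))"
  shows "(\<lambda>n. (\<Sum>m=n0..n. summand m) / E n) \<longlonglongrightarrow> c"
proof (rule sum_asymp)
  show "(\<lambda>n. Y n * E n / E n) \<longlonglongrightarrow> c"
    using Y_tendsto by simp
  show "(\<lambda>n. cmod (summand (Suc n) - (Y (Suc n) * E (Suc n) - Y n * E n))) \<in> o(\<lambda>n. M n * Im (\<theta> (Suc n)))"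
  proof -
    have "(\<lambda>n. exp (2 * Im (\<theta> (Suc n)))) \<longlonglongrightarrow> exp (2 * Im 0)"
      by (intro tendsto_intros \<theta>_Suc_tendsto_0)
    then have "(\<lambda>n. exp (2 * Im (\<theta> (Suc n)))) \<in> O(\<lambda>_. 1)"
      by (intro bigoI_tendsto[where c = 1]) auto
    from landau_o.big_small_mult[OF landau_o.big.mult_left[OF this] slow, of M]
    have "(\<lambda>n. M n * exp (2 * Im (\<theta> (Suc n))) * cmod (Y (Suc n) - Y n)) \<in> o(\<lambda>n. M n * Im (\<theta> (Suc n)))"
      by simp
    also have "?this \<longleftrightarrow> ?thesis"
    proof (rule landau_o.small.in_cong)
      show "\<forall>\<^sub>F n in sequentially. M n * exp (2 * Im (\<theta> (Suc n))) * cmod (Y (Suc n) - Y n)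
              = cmod (summand (Suc n) - (Y (Suc n) * E (Suc n) - Y n * E n))"
        using summand_eq ev_N
      proof eventually_elim
        case (elim n)
        have "summand (Suc n) - (Y (Suc n) * E (Suc n) - Y n * E n) = - (E (Suc n) * (Y (Suc n) - Y n))"
          using elim by (simp add: algebra_simps)
        then have "cmod (summand (Suc n) - (Y (Suc n) * E (Suc n) - Y n * E n)) = M (Suc n) * cmod (Y (Suc n) - Y n)"
          by (simp add: norm_mult norm_E)
        then show ?case
          using elim by (simp add: M_Suc)
      qed
    qed
    finally show ?thesis .
  qed
qed

end

section \<open>Calculus of power bounds\<close>

text \<open>The errors are complex, and the Landau symbols compare functions with values in one field.\<close>

abbreviation (input) pw :: "real \<Rightarrow> nat \<Rightarrow> complex" where
  "pw s \<equiv> \<lambda>n. complex_of_real (real n powr s)"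

lemma pw_mult:
  assumes "F \<in> O(pw s)" "G \<in> O(pw t)"
  shows "(\<lambda>n. F n * G n) \<in> O(pw (s + t))"
  using landau_o.big.mult[OF assms] by (simp add: powr_add)

lemma pw_mono:
  assumes "F \<in> O(pw s)" "s \<le> t"
  shows "F \<in> O(pw t)"
proof -
  have "(\<lambda>n. real n powr s) \<in> O(\<lambda>n. real n powr t)"
    using assms(2) by (intro bigoI[of _ 1]) (auto intro!: eventually_sequentiallyI[of 1] powr_mono)
  then have "pw s \<in> O(pw t)"
    by (simp add: landau_o.big.of_real_iff)
  with assms(1) show ?thesis
    by (rule landau_o.big_trans)
qed

lemma pw_of_real: "F \<in> O(\<lambda>n. real n powr s) \<Longrightarrow> (\<lambda>n. complex_of_real (F n)) \<in> O(pw s)"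
  by (simp add: landau_o.big.of_real_iff)

lemma pw_Suc:
  assumes "F \<in> O(pw s)"
  shows "(\<lambda>n. F (Suc n)) \<in> O(pw s)"
proof -
  have "(\<lambda>n. real (Suc n) powr s) \<in> O(\<lambda>n. real n powr s)"
    by real_asymp
  then have "(\<lambda>n. pw s (Suc n)) \<in> O(pw s)"
    by (rule pw_of_real)
  with landau_o.big.compose[OF assms filterlim_Suc] show ?thesis
    by (rule landau_o.big_trans)
qed

lemma pw_bounded: "F \<longlonglongrightarrow> l \<Longrightarrow> F \<in> O(pw 0)"
proof -
  assume F: "F \<longlonglongrightarrow> l"
  have "(\<lambda>n. F n / 1) \<longlonglongrightarrow> l" using F by simp
  then have "F \<in> O(\<lambda>_. 1)" by (rule bigoI_tendsto) simp
  also have "(\<lambda>_. 1) \<in> O(pw 0)"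
    by (intro bigoI[of _ 1]) (auto intro!: eventually_sequentiallyI[of 1])
  finally show ?thesis .
qed

lemma pw_const: "(\<lambda>_. k) \<in> O(pw 0)"
  by (rule pw_bounded) (rule tendsto_const)

lemma pw_norm:
  assumes "F \<in> O(pw s)"
  shows "(\<lambda>n. cmod (F n)) \<in> O(\<lambda>n. real n powr s)"
proof -
  have "(\<lambda>n. cmod (F n)) \<in> O(\<lambda>n. cmod (pw s n))"
    using assms by (simp only: landau_o.big.norm_iff)
  then show ?thesis
    by (simp only: norm_of_real abs_of_nonneg powr_ge_zero)
qed

lemma pw_power: "F \<in> O(pw s) \<Longrightarrow> (\<lambda>n. F n ^ k) \<in> O(pw (real k * s))"
proof (induction k)
  case 0
  then show ?case using pw_bounded[of "\<lambda>_. 1" 1] by simp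
next
  case (Suc k)
  from pw_mult[OF Suc.prems Suc.IH[OF Suc.prems]] show ?case
    by (simp add: ring_distribs)
qed

lemma pw_tendsto_0:
  assumes "F \<in> O(pw s)" "s < 0"
  shows "F \<longlonglongrightarrow> 0"
proof -
  have "(\<lambda>n. real n powr s) \<longlonglongrightarrow> 0"
    using assms(2) by real_asymp
  then have "pw s \<longlonglongrightarrow> of_real 0"
    by (rule tendsto_of_real)
  then have "pw s \<in> o(\<lambda>_. 1)"
    by (intro smalloI_tendsto) auto
  from smalloD_tendsto[OF landau_o.big_small_trans[OF assms(1) this]] show ?thesis
    by simp
qed

lemma exp_pw:
  assumes "F \<in> O(pw s)" "s < 0"
  shows "(\<lambda>n. exp (F n) - (\<Sum>k\<le>K. F n ^ k / fact k)) \<in> O(pw (real (Suc K) * s))"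
  using exp_taylor_bigo[OF pw_tendsto_0[OF assms]] pw_power[OF assms(1)]
  by (rule landau_o.big_trans)

lemmas pw_add = sum_in_bigo(1)
lemmas pw_diff = sum_in_bigo(2)

text \<open>The product rule for increments; the sequence \<open>Y\<close> is treated factor by factor.\<close>

lemma slow_mult:
  assumes "F \<longlonglongrightarrow> l" "G \<longlonglongrightarrow> m"
    and "(\<lambda>n. F (Suc n) - F n) \<in> O(pw s)" "(\<lambda>n. G (Suc n) - G n) \<in> O(pw s)"
  shows "(\<lambda>n. F (Suc n) * G (Suc n) - F n * G n) \<in> O(pw s)"
proof -
  have "(\<lambda>n. F (Suc n) * (G (Suc n) - G n) + (F (Suc n) - F n) * G n) \<in> O(pw s)"
    using pw_mult[OF pw_bounded[OF LIMSEQ_Suc[OF assms(1)]] assms(4)]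
          pw_mult[OF assms(3) pw_bounded[OF assms(2)]]
    by (intro pw_add) auto
  then show ?thesis
    by (simp add: algebra_simps)
qed

section \<open>Square roots of decaying sequences\<close>

text \<open>A positive factor passes through the branch, after which continuity of the branch at \<open>l\<close> applies.\<close>

lemma bsqrt_decay:
  fixes T :: "nat \<Rightarrow> complex"
  assumes lim: "(\<lambda>n. of_real (real n powr (2 * \<nu>)) * T n) \<longlonglongrightarrow> l" and l: "l \<notin> \<real>\<^sub>\<ge>\<^sub>0"
  shows "(\<lambda>n. of_real (real n powr \<nu>) * bsqrt (T n)) \<longlonglongrightarrow> bsqrt l"
proof -
  have "- l \<notin> \<real>\<^sub>\<le>\<^sub>0"
    using l by (auto simp: complex_nonpos_Reals_iff complex_nonneg_Reals_iff)
  then have "isCont csqrt (- l)"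
    by (rule continuous_at_csqrt)
  then have "(\<lambda>n. csqrt (- (of_real (real n powr (2 * \<nu>)) * T n))) \<longlonglongrightarrow> csqrt (- l)"
    by (rule isCont_tendsto_compose) (intro tendsto_intros lim)
  then have "(\<lambda>n. \<i> * csqrt (- (of_real (real n powr (2 * \<nu>)) * T n))) \<longlonglongrightarrow> \<i> * csqrt (- l)"
    by (intro tendsto_intros)
  moreover have "\<i> * csqrt (- (of_real (real n powr (2 * \<nu>)) * T n)) = of_real (real n powr \<nu>) * bsqrt (T n)" for n
  proof -
    have "csqrt (of_real (real n powr (2 * \<nu>)) * - T n) = of_real (real n powr \<nu>) * csqrt (- T n)"
    proof (cases "n = 0")
      case False
      define q where "q = csqrt (- T n)"
      have q: "0 < Re q \<or> Re q = 0 \<and> 0 \<le> Im q"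
        unfolding q_def by (rule csqrt_principal)
      have "(of_real (real n powr \<nu>) * q)\<^sup>2 = of_real (real n powr (2 * \<nu>)) * - T n"
        using False by (simp add: q_def power_mult_distrib powr_power flip: of_real_power)
      then have "csqrt (of_real (real n powr (2 * \<nu>)) * - T n) = of_real (real n powr \<nu>) * q"
        by (rule csqrt_unique) (use q False in auto)
      then show ?thesis by (simp add: q_def)
    qed simp
    then show ?thesis by (simp add: bsqrt_def)
  qed
  ultimately show ?thesis
    by (simp add: bsqrt_def)
qed

section \<open>The oscillating case: the exponents\<close>

text \<open>Here \<open>K n\<^sup>2\<close> tends to \<open>- \<tau> > 0\<close>, a point of the cut, so the limit of the root depends on the side from
  which it is approached, that is, on the sign of \<open>Im w\<close>.\<close>

locale oscillating =
  fixes \<sigma> \<tau> :: real and w :: complex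
  assumes \<sigma>: "1 < \<sigma>" "\<sigma> < 3 / 2" and \<tau>_neg: "\<tau> < 0" and Im_w: "Im w \<noteq> 0"
begin

definition th :: "nat \<Rightarrow> complex" where "th n = bsqrt (tt \<sigma> \<tau> n w)"
definition K :: "nat \<Rightarrow> complex" where "K n = of_real (real n powr (1/2)) * th n"
definition \<kappa>\<^sub>0 :: complex where
  "\<kappa>\<^sub>0 = (if Im w \<ge> 0 then of_real (sqrt \<bar>\<tau>\<bar>) else - of_real (sqrt \<bar>\<tau>\<bar>))"

lemma th_sq: "th n ^ 2 = tt \<sigma> \<tau> n w"
  by (simp add: th_def bsqrt_square)

lemma K_sq: "n \<ge> 1 \<Longrightarrow> K n ^ 2 = - of_real \<tau> + w * of_real (real n powr (1 - \<sigma>))"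
proof -
  assume n: "n \<ge> 1"
  have p: "(real n powr (1/2))\<^sup>2 = real n"
    using n by (simp add: powr_half_sqrt)
  have q: "real n * real n powr (-\<sigma>) = real n powr (1 - \<sigma>)"
    using n by (simp add: powr_diff powr_minus divide_inverse)
  have "K n ^ 2 = of_real ((real n powr (1/2))\<^sup>2) * tt \<sigma> \<tau> n w"
    by (simp add: K_def power_mult_distrib th_sq)
  also have "\<dots> = - of_real \<tau> + w * of_real (real n * real n powr (-\<sigma>))"
    unfolding p tt_def using n by (simp add: algebra_simps)
  finally show ?thesis unfolding q .
qed

lemma Re_Im_th: "2 * Re (th n) * Im (th n) = Im w * real n powr (-\<sigma>)"
  using arg_cong[OF th_sq[of n], of Im] by (simp add: tt_def power2_eq_square mult_ac)

lemma Im_th_pos: "n \<ge> 1 \<Longrightarrow> Im (th n) > 0"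
proof -
  assume n: "n \<ge> 1"
  have "Im (tt \<sigma> \<tau> n w) \<noteq> 0"
    using Im_w n by (simp add: tt_def)
  then have "tt \<sigma> \<tau> n w \<notin> \<real>\<^sub>\<ge>\<^sub>0"
    by (auto simp: complex_nonneg_Reals_iff)
  then show ?thesis
    unfolding th_def by (rule Im_bsqrt_pos)
qed

lemma \<kappa>\<^sub>0_sq: "\<kappa>\<^sub>0 ^ 2 = - of_real \<tau>"
  using \<tau>_neg by (simp add: \<kappa>\<^sub>0_def flip: of_real_power)

lemma \<kappa>\<^sub>0_nz: "\<kappa>\<^sub>0 \<noteq> 0"
  using \<tau>_neg by (simp add: \<kappa>\<^sub>0_def)

text \<open>The signs of \<open>Re (th n)\<close> and \<open>Im w\<close> agree because \<open>Im (th n) > 0\<close>. So \<open>K n + \<kappa>\<^sub>0\<close> stays away from zero, and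
  \<open>K n - \<kappa>\<^sub>0\<close> is bounded by the difference of the squares.\<close>

lemma K_tendsto: "K \<longlonglongrightarrow> \<kappa>\<^sub>0"
proof -
  have sep: "cmod (K n + \<kappa>\<^sub>0) \<ge> cmod \<kappa>\<^sub>0" if "n \<ge> 1" for n
  proof -
    have pos: "real n powr (1/2) > 0" using that by simp
    have ReK: "Re (K n) = real n powr (1/2) * Re (th n)" by (simp add: K_def)
    have "Re (th n) * Im w > 0"
    proof -
      have "(Re (th n) * Im w) * (2 * Im (th n)) = (Im w)\<^sup>2 * real n powr (-\<sigma>)"
        using Re_Im_th[of n] by (simp add: power2_eq_square algebra_simps)
      also have "\<dots> > 0" using Im_w that by simp
      finally show ?thesis
        using Im_th_pos[OF that] by (simp add: zero_less_mult_iff)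
    qed
    then have "Re (K n) * Im w > 0"
      unfolding ReK using pos by (simp add: mult.assoc)
    then have "\<bar>Re (K n + \<kappa>\<^sub>0)\<bar> \<ge> cmod \<kappa>\<^sub>0"
      by (auto simp: \<kappa>\<^sub>0_def zero_less_mult_iff)
    then show ?thesis
      using abs_Re_le_cmod[of "K n + \<kappa>\<^sub>0"] by linarith
  qed
  have "(\<lambda>n. real n powr (1 - \<sigma>)) \<longlonglongrightarrow> 0"
    using \<sigma> by real_asymp
  then have "(\<lambda>n. cmod (w * of_real (real n powr (1 - \<sigma>))) / cmod \<kappa>\<^sub>0) \<longlonglongrightarrow> cmod (w * of_real 0) / cmod \<kappa>\<^sub>0"
    by (intro tendsto_intros) (use \<kappa>\<^sub>0_nz in auto)
  then have lim: "(\<lambda>n. cmod (w * of_real (real n powr (1 - \<sigma>))) / cmod \<kappa>\<^sub>0) \<longlonglongrightarrow> 0"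
    by simp
  have "(\<lambda>n. K n - \<kappa>\<^sub>0) \<longlonglongrightarrow> 0"
  proof (rule Lim_null_comparison[OF _ lim])
    show "\<forall>\<^sub>F n in sequentially. norm (K n - \<kappa>\<^sub>0) \<le> cmod (w * of_real (real n powr (1 - \<sigma>))) / cmod \<kappa>\<^sub>0"
      using eventually_ge_at_top[of 1]
    proof eventually_elim
      case (elim n)
      have "(K n - \<kappa>\<^sub>0) * (K n + \<kappa>\<^sub>0) = w * of_real (real n powr (1 - \<sigma>))"
        using K_sq[OF elim] \<kappa>\<^sub>0_sq by (simp add: power2_eq_square algebra_simps)
      then have "cmod (K n - \<kappa>\<^sub>0) * cmod (K n + \<kappa>\<^sub>0) = cmod (w * of_real (real n powr (1 - \<sigma>)))"
        by (metis norm_mult)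
      moreover have "cmod (K n - \<kappa>\<^sub>0) * cmod \<kappa>\<^sub>0 \<le> cmod (K n - \<kappa>\<^sub>0) * cmod (K n + \<kappa>\<^sub>0)"
        by (intro mult_left_mono sep elim) simp
      ultimately show ?case
        using \<kappa>\<^sub>0_nz by (simp add: field_simps)
    qed
  qed
  then show ?thesis
    by (simp add: LIM_zero_iff)
qed

lemma K_increment: "(\<lambda>n. K (Suc n) - K n) \<in> O(pw (- \<sigma>))"
proof -
  have "(\<lambda>n. 1 / (K (Suc n) + K n)) \<longlonglongrightarrow> 1 / (\<kappa>\<^sub>0 + \<kappa>\<^sub>0)"
    by (intro tendsto_intros K_tendsto LIMSEQ_Suc[OF K_tendsto]) (use \<kappa>\<^sub>0_nz in auto)
  note b = pw_bounded[OF this]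
  have "(\<lambda>n. real (Suc n) powr (1 - \<sigma>) - real n powr (1 - \<sigma>)) \<in> O(\<lambda>n. real n powr (- \<sigma>))"
    by real_asymp
  from pw_of_real[OF this]
  have "(\<lambda>n. w * of_real (real (Suc n) powr (1 - \<sigma>) - real n powr (1 - \<sigma>))) \<in> O(pw (- \<sigma>))"
    using Im_w by (subst landau_o.big.cmult_in_iff) auto
  from pw_mult[OF this b]
  have "(\<lambda>n. w * of_real (real (Suc n) powr (1 - \<sigma>) - real n powr (1 - \<sigma>)) * (1 / (K (Suc n) + K n))) \<in> O(pw (- \<sigma>))"
    by simp
  also have "?this \<longleftrightarrow> ?thesis"
  proof (rule landau_o.big.in_cong)
    have "(\<lambda>n. K (Suc n) + K n) \<longlonglongrightarrow> \<kappa>\<^sub>0 + \<kappa>\<^sub>0"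
      by (intro tendsto_intros K_tendsto LIMSEQ_Suc[OF K_tendsto])
    then have "\<forall>\<^sub>F n in sequentially. K (Suc n) + K n \<noteq> 0"
      by (rule tendsto_imp_eventually_ne) (use \<kappa>\<^sub>0_nz in auto)
    then show "\<forall>\<^sub>F n in sequentially. w * of_real (real (Suc n) powr (1 - \<sigma>) - real n powr (1 - \<sigma>)) * (1 / (K (Suc n) + K n))
       = K (Suc n) - K n"
      using eventually_ge_at_top[of 1]
    proof eventually_elim
      case (elim n)
      have "w * of_real (real (Suc n) powr (1 - \<sigma>) - real n powr (1 - \<sigma>)) = K (Suc n) ^ 2 - K n ^ 2"
        using elim by (subst (1 2) K_sq) (simp_all add: algebra_simps)
      also have "\<dots> = (K (Suc n) - K n) * (K (Suc n) + K n)"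
        by (simp add: power2_eq_square algebra_simps)
      finally show ?case
        using elim by simp
    qed
  qed
  finally show ?thesis .
qed

lemma th_eq: "n \<ge> 1 \<Longrightarrow> th n = of_real (real n powr (-1/2)) * K n"
  by (simp add: K_def powr_minus flip: mult.assoc of_real_mult)

lemma th_bigo: "th \<in> O(pw (-1/2))"
proof -
  have "pw (-1/2) \<in> O(pw (-1/2))" by simp
  from pw_mult[OF this pw_bounded[OF K_tendsto]]
  have "(\<lambda>n. of_real (real n powr (-1/2)) * K n) \<in> O(pw (-1/2))" by simp
  also have "?this \<longleftrightarrow> ?thesis"
    by (intro landau_o.big.in_cong eventually_sequentiallyI[of 1]) (simp add: th_eq)
  finally show ?thesis .
qed

text \<open>The term \<open>th n / (2 * n)\<close> comes from the factor \<open>n powr (- 1 / 2)\<close> of \<open>th\<close>; the remainder comes from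
  \<open>K_increment\<close>.\<close>

lemma th_increment:
  "(\<lambda>n. th (Suc n) - th n + th n / (2 * of_nat n)) \<in> O(pw (- \<sigma> - 1/2))"
proof -
  have "(\<lambda>n. real (Suc n) powr (-1/2)) \<in> O(\<lambda>n. real n powr (-1/2))"
    by real_asymp
  note 1 = pw_mono[OF pw_mult[OF pw_of_real[OF this] K_increment], of "- \<sigma> - 1/2"]
  have "(\<lambda>n. real (Suc n) powr (-1/2) - real n powr (-1/2) + real n powr (-1/2) / (2 * real n))
           \<in> O(\<lambda>n. real n powr (-5/2))"
    by real_asymp
  note 2 = pw_mono[OF pw_mult[OF pw_of_real[OF this] pw_bounded[OF K_tendsto]], of "- \<sigma> - 1/2"]
  have "(\<lambda>n. of_real (real (Suc n) powr (-1/2)) * (K (Suc n) - K n)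
     + of_real (real (Suc n) powr (-1/2) - real n powr (-1/2) + real n powr (-1/2) / (2 * real n)) * K n)
      \<in> O(pw (- \<sigma> - 1/2))"
    by (intro pw_add 1 2) (use \<sigma> in simp_all)
  also have "?this \<longleftrightarrow> ?thesis"
  proof (rule landau_o.big.in_cong)
    show "\<forall>\<^sub>F n in sequentially. of_real (real (Suc n) powr (-1/2)) * (K (Suc n) - K n)
     + of_real (real (Suc n) powr (-1/2) - real n powr (-1/2) + real n powr (-1/2) / (2 * real n)) * K n
       = th (Suc n) - th n + th n / (2 * of_nat n)"
      using eventually_ge_at_top[of 1]
      by eventually_elim (simp add: th_eq algebra_simps)
  qed
  finally show ?thesis .
qed

lemma th_tendsto: "th \<longlonglongrightarrow> 0"
  by (rule pw_tendsto_0[OF th_bigo]) simp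

text \<open>In \<open>Re_Im_th\<close> the real part is at most of size \<open>n powr (- 1 / 2)\<close>, which bounds the imaginary part from
  below.\<close>

lemma Im_th_lower: "(\<lambda>n. real n powr (1/2 - \<sigma>)) \<in> O(\<lambda>n. Im (th n))"
proof -
  obtain C where C: "C > 0" "\<forall>\<^sub>F n in sequentially. cmod (th n) \<le> C * cmod (pw (-1/2) n)"
    using landau_o.bigE[OF th_bigo] by blast
  show ?thesis
  proof (rule bigoI[of _ "2 * C / \<bar>Im w\<bar>"])
    show "\<forall>\<^sub>F n in sequentially. norm (real n powr (1/2 - \<sigma>)) \<le> 2 * C / \<bar>Im w\<bar> * norm (Im (th n))"
      using C(2) eventually_ge_at_top[of 1]
    proof eventually_elim
      case (elim n)
      have "\<bar>Im w\<bar> * real n powr (1/2 - \<sigma>) = real n powr (1/2) * \<bar>Im w * real n powr (-\<sigma>)\<bar>"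
        using powr_add[of "real n" "1/2" "-\<sigma>"] by (simp add: abs_mult)
      also have "\<dots> = 2 * real n powr (1/2) * \<bar>Re (th n)\<bar> * \<bar>Im (th n)\<bar>"
        by (simp add: Re_Im_th[symmetric] abs_mult)
      also have "\<dots> \<le> 2 * real n powr (1/2) * (C * real n powr (-1/2)) * \<bar>Im (th n)\<bar>"
        using elim(1) abs_Re_le_cmod[of "th n"]
        by (intro mult_right_mono mult_left_mono) auto
      also have "\<dots> = 2 * C * \<bar>Im (th n)\<bar> * (real n powr (1/2) * real n powr (-1/2))"
        by (simp only: mult_ac)
      also have "real n powr (1/2) * real n powr (-1/2) = 1"
        using elim(2) by (simp flip: powr_add)
      finally show ?case
        using Im_w by (simp add: field_simps)
    qed
  qed
qed

lemma Im_th_growth: "filterlim (\<lambda>n. real n * Im (th n)) at_top sequentially"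
proof -
  obtain C where C: "C > 0" "\<forall>\<^sub>F n in sequentially. norm (real n powr (1/2 - \<sigma>)) \<le> C * norm (Im (th n))"
    using landau_o.bigE[OF Im_th_lower] by blast
  have "filterlim (\<lambda>n. real n powr (3/2 - \<sigma>) / C) at_top sequentially"
    using \<sigma> C(1) by real_asymp
  then show ?thesis
  proof (rule filterlim_at_top_mono)
    show "\<forall>\<^sub>F n in sequentially. real n powr (3/2 - \<sigma>) / C \<le> real n * Im (th n)"
      using C(2) eventually_ge_at_top[of 1]
    proof eventually_elim
      case (elim n)
      have "real n powr (3/2 - \<sigma>) = real n powr (1 + (1/2 - \<sigma>))"
        by simp
      also have "\<dots> = real n * real n powr (1/2 - \<sigma>)"
        using elim by (subst powr_add) simp
      also have "\<dots> \<le> real n * (C * Im (th n))"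
        using elim Im_th_pos[of n] by (intro mult_left_mono) auto
      finally show ?case
        using C(1) by (simp add: field_simps)
    qed
  qed
qed

lemma inverse_n_bigo: "(\<lambda>n. 1 / of_nat n) \<in> O(pw (-1))"
proof -
  have "(\<lambda>n. 1 / real n) \<in> O(\<lambda>n. real n powr (-1))"
    by real_asymp
  from pw_of_real[OF this] show ?thesis by simp
qed

lemma th_step_bigo: "(\<lambda>n. th (Suc n) - th n) \<in> O(pw (-3/2))"
proof -
  have 1: "(\<lambda>n. th n * (1 / of_nat n)) \<in> O(pw (-3/2))"
    using pw_mult[OF th_bigo inverse_n_bigo] by simp
  have 2: "(\<lambda>n. th (Suc n) - th n + th n / (2 * of_nat n)) \<in> O(pw (-3/2))"
    by (rule pw_mono[OF th_increment]) (use \<sigma> in simp)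
  have 3: "(\<lambda>n. 1/2 * (th n * (1 / of_nat n))) \<in> O(pw (-3/2))"
    using 1 by (subst landau_o.big.cmult_in_iff) auto
  have "(\<lambda>n. (th (Suc n) - th n + th n / (2 * of_nat n)) - 1/2 * (th n * (1 / of_nat n))) \<in> O(pw (-3/2))"
    by (rule pw_diff[OF 2 3])
  then show ?thesis
    by simp
qed

lemma i_th_bigo: "(\<lambda>n. \<i> * th n) \<in> O(pw (-1/2))"  "(\<lambda>n. - (\<i> * th n)) \<in> O(pw (-1/2))"
  using th_bigo by simp_all

lemma exp_th_step:
  "(\<lambda>n. exp (\<i> * th (Suc n)) - exp (\<i> * th n) + \<i> * th n / (2 * of_nat n)) \<in> O(pw (- \<sigma> - 1/2))"
proof -
  define \<delta> where "\<delta> n = th (Suc n) - th n" for n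
  have \<delta>: "(\<lambda>n. \<i> * \<delta> n) \<in> O(pw (-3/2))"
    using th_step_bigo by (simp add: \<delta>_def)
  have 1: "(\<lambda>n. exp (\<i> * \<delta> n) - 1) \<in> O(pw (-3/2))"
    using exp_pw[OF \<delta>, of 0] by simp
  have 2: "(\<lambda>n. exp (\<i> * th n) - 1) \<in> O(pw (-1/2))"
    using exp_pw[OF i_th_bigo(1), of 0] by simp
  have 3: "(\<lambda>n. exp (\<i> * \<delta> n) - 1 - \<i> * \<delta> n) \<in> O(pw (-3))"
    using exp_pw[OF \<delta>, of 1] by (simp add: algebra_simps)
  have 4: "(\<lambda>n. \<i> * (\<delta> n + th n / (2 * of_nat n))) \<in> O(pw (- \<sigma> - 1/2))"
    using th_increment by (simp add: \<delta>_def)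
  have "(\<lambda>n. (exp (\<i> * th n) - 1) * (exp (\<i> * \<delta> n) - 1) + (exp (\<i> * \<delta> n) - 1 - \<i> * \<delta> n)
     + \<i> * (\<delta> n + th n / (2 * of_nat n))) \<in> O(pw (- \<sigma> - 1/2))"
    by (intro pw_add 4 pw_mono[OF 3] pw_mono[OF pw_mult[OF 2 1]]) (use \<sigma> in simp_all)
  also have "(\<lambda>n. (exp (\<i> * th n) - 1) * (exp (\<i> * \<delta> n) - 1) + (exp (\<i> * \<delta> n) - 1 - \<i> * \<delta> n)
     + \<i> * (\<delta> n + th n / (2 * of_nat n)))
     = (\<lambda>n. exp (\<i> * th (Suc n)) - exp (\<i> * th n) + \<i> * th n / (2 * of_nat n))"
  proof
    fix n
    have "exp (\<i> * th (Suc n)) = exp (\<i> * th n) * exp (\<i> * \<delta> n)"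
      by (simp add: \<delta>_def right_diff_distrib flip: exp_add)
    then show "(exp (\<i> * th n) - 1) * (exp (\<i> * \<delta> n) - 1) + (exp (\<i> * \<delta> n) - 1 - \<i> * \<delta> n)
     + \<i> * (\<delta> n + th n / (2 * of_nat n))
     = exp (\<i> * th (Suc n)) - exp (\<i> * th n) + \<i> * th n / (2 * of_nat n)"
      by (simp add: algebra_simps)
  qed
  finally show ?thesis .
qed

lemma exp_taylor_2: "(\<Sum>k\<le>2. x ^ k / fact k) = 1 + x + x ^ 2 / 2" for x :: complex
  by (simp add: numeral_2_eq_2)

lemma exp_taylor_3: "(\<Sum>k\<le>3. x ^ k / fact k) = 1 + x + x ^ 2 / 2 + x ^ 3 / 6" for x :: complex
  by (simp add: numeral_3_eq_3 numeral_2_eq_2)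

lemma exp_th_sum: "(\<lambda>n. exp (- (\<i> * th n)) + exp (\<i> * th n) - 2 + th n ^ 2) \<in> O(pw (-2))"
proof -
  (* The odd powers cancel in the sum, so that expanding to third order leaves an error of fourth order. *)
  have "(\<lambda>n. (exp (\<i> * th n) - (\<Sum>k\<le>3. (\<i> * th n) ^ k / fact k))
           + (exp (- (\<i> * th n)) - (\<Sum>k\<le>3. (- (\<i> * th n)) ^ k / fact k))) \<in> O(pw (-2))"
    by (intro pw_add pw_mono[OF exp_pw[OF i_th_bigo(1), of 3]] pw_mono[OF exp_pw[OF i_th_bigo(2), of 3]])
      simp_all
  moreover have "(exp (\<i> * th n) - (\<Sum>k\<le>3. (\<i> * th n) ^ k / fact k))
           + (exp (- (\<i> * th n)) - (\<Sum>k\<le>3. (- (\<i> * th n)) ^ k / fact k))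
       = exp (- (\<i> * th n)) + exp (\<i> * th n) - 2 + th n ^ 2" for n
  proof -
    have *: "(e1 - (1 + x + x ^ 2 / 2 + x ^ 3 / 6)) + (e2 - (1 + - x + (- x) ^ 2 / 2 + (- x) ^ 3 / 6))
            = e2 + e1 - 2 - x ^ 2" for e1 e2 x :: complex
      by (simp add: power3_eq_cube power2_eq_square)
    have "(\<i> * th n) ^ 2 = - (th n ^ 2)"
      by (simp add: power_mult_distrib)
    then show ?thesis
      unfolding exp_taylor_3 * by simp
  qed
  ultimately show ?thesis
    by (simp only:)
qed

lemma sin_th: "(\<lambda>n. sin (th n) - th n) \<in> O(pw (-3/2))"
proof -
  have "(\<lambda>n. (exp (\<i> * th n) - (\<Sum>k\<le>2. (\<i> * th n) ^ k / fact k))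
           - (exp (- (\<i> * th n)) - (\<Sum>k\<le>2. (- (\<i> * th n)) ^ k / fact k))) \<in> O(pw (-3/2))"
    by (intro pw_diff pw_mono[OF exp_pw[OF i_th_bigo(1), of 2]] pw_mono[OF exp_pw[OF i_th_bigo(2), of 2]])
      simp_all
  moreover have "(exp (\<i> * th n) - (\<Sum>k\<le>2. (\<i> * th n) ^ k / fact k))
           - (exp (- (\<i> * th n)) - (\<Sum>k\<le>2. (- (\<i> * th n)) ^ k / fact k))
        = 2 * \<i> * (sin (th n) - th n)" for n
  proof -
    have "(e1 - (1 + x + x ^ 2 / 2)) - (e2 - (1 + - x + (- x) ^ 2 / 2)) = e1 - e2 - 2 * x"
      for e1 e2 x :: complex
      by (simp add: power2_eq_square)
    moreover have "exp (\<i> * th n) - exp (- (\<i> * th n)) = 2 * \<i> * sin (th n)"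
      by (simp add: sin_exp_eq)
    ultimately show ?thesis
      unfolding exp_taylor_2 by (simp add: right_diff_distrib mult.assoc)
  qed
  ultimately have "(\<lambda>n. 2 * \<i> * (sin (th n) - th n)) \<in> O(pw (-3/2))"
    by (simp only:)
  then show ?thesis
    by (subst (asm) landau_o.big.cmult_in_iff) auto
qed

end

section \<open>Slow variation in the oscillating case\<close>

lemma telescope: "(x - y) * r + (y * r - k) = x * r - k" for x y r k :: real
  by (simp add: left_diff_distrib)

text \<open>The data of the theorem for \<open>\<sigma> > 1\<close>, \<open>\<tau> < 0\<close>. The sign \<open>\<omega>\<close> is \<open>- \<gamma>\<close> and \<open>w\<close> is \<open>\<gamma> z\<close>.\<close>

locale oscillating_jacobi = oscillating +
  fixes \<omega> \<alpha> \<beta> :: real and a b :: "nat \<Rightarrow> real" and z :: complex and N :: nat and f :: "nat \<Rightarrow> complex"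
  assumes sign: "\<omega> * \<omega> = 1"
    and pos: "\<And>n. a n > 0"
    and a_expansion: "(\<lambda>n. a n / real n powr \<sigma> - (1 + \<alpha> / real n)) \<in> O(\<lambda>n. 1 / real n ^ 2)"
    and b_expansion: "(\<lambda>n. - \<omega> * b n / (2 * real n powr \<sigma>) - (1 + \<beta> / real n)) \<in> O(\<lambda>n. 1 / real n ^ 2)"
    and \<tau>_eq: "\<tau> = 2 * \<beta> - 2 * \<alpha> + \<sigma>"
    and w_eq: "w = - of_real \<omega> * z"
    and solution: "jacobi_solution a b z f"
    and f_WKB: "f \<sim>[sequentially] (\<lambda>n. of_real \<omega> ^ n * of_real (real n powr (- rho \<sigma>))
                    * exp (\<i> * (\<Sum>m=N..n. th m)))"
begin

lemma rho_eq: "rho \<sigma> = \<sigma> / 2 - 1 / 4"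
  using \<sigma> by (simp add: rho_def)

sublocale wkb \<omega> "rho \<sigma>" "1 / 2" a th \<kappa>\<^sub>0 N f
proof
  show "(\<lambda>n. a n * real n powr (- (2 * rho \<sigma> + 1 / 2))) \<longlonglongrightarrow> 1"
  proof -
    have "- (2 * rho \<sigma> + 1 / 2) = - \<sigma>"
      by (simp add: rho_eq)
    then show ?thesis
      using ratio_tendsto_1[OF a_expansion] by (simp only: powr_minus divide_inverse)
  qed
  show "(\<lambda>n. of_real (real n powr (1 / 2)) * th n) \<longlonglongrightarrow> \<kappa>\<^sub>0"
    using K_tendsto by (simp add: K_def[abs_def])
qed (use sign pos \<kappa>\<^sub>0_nz Im_th_growth f_WKB in auto)

text \<open>The relative residual of the ansatz \<open>A\<close> in the recurrence.\<close>

definition R :: "nat \<Rightarrow> complex" where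
  "R n = (of_real (a (n - 1)) * A (n - 1) + (of_real (b n) - z) * A n + of_real (a n) * A (Suc n)) / A n"

text \<open>The coefficients of the two neighbours in \<open>R n\<close>, with the power factors of \<open>A\<close> absorbed and normalised to have
  limit 1.\<close>

definition aL :: "nat \<Rightarrow> real" where
  "aL n = a (n - 1) / real n powr \<sigma> * (real (n - 1) powr (- rho \<sigma>) / real n powr (- rho \<sigma>))"
definition aR :: "nat \<Rightarrow> real" where
  "aR n = a n / real n powr \<sigma> * (real (Suc n) powr (- rho \<sigma>) / real n powr (- rho \<sigma>))"

lemma A_Suc:
  assumes "k \<ge> 1" "Suc k \<ge> N"
  shows "A (Suc k) = of_real \<omega> * A k
     * of_real (real (Suc k) powr (- rho \<sigma>) / real k powr (- rho \<sigma>)) * exp (\<i> * th (Suc k))"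
  using assms by (simp add: A_def \<Phi>_Suc ring_distribs exp_add)

lemma R_eq:
  assumes "n \<ge> 2" "n \<ge> N"
  shows "R n = of_real (\<omega> * real n powr \<sigma>) *
     (of_real (aL n) * exp (- (\<i> * th n)) + of_real (\<omega> * b n / real n powr \<sigma>)
      + w * of_real (real n powr (- \<sigma>)) + of_real (aR n) * exp (\<i> * th (Suc n)))"
proof -
  have n0: "real n powr \<sigma> \<noteq> 0" "real n powr (- rho \<sigma>) \<noteq> 0" "real (n - 1) powr (- rho \<sigma>) \<noteq> 0"
    using assms by auto
  have w2: "complex_of_real \<omega> * complex_of_real \<omega> = 1"
    using sign by (simp flip: of_real_mult)
  define q where "q = real (n - 1) powr (- rho \<sigma>) / real n powr (- rho \<sigma>)"
  define r where "r = real (Suc n) powr (- rho \<sigma>) / real n powr (- rho \<sigma>)"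
  have "A n = of_real \<omega> * A (n - 1) * of_real (1 / q) * exp (\<i> * th n)"
    using A_Suc[of "n - 1"] assms by (simp add: q_def)
  then have "of_real \<omega> * of_real q * exp (- (\<i> * th n)) * A n
      = (of_real \<omega> * of_real \<omega>) * A (n - 1) * of_real (q * (1 / q)) * (exp (- (\<i> * th n)) * exp (\<i> * th n))"
    by (simp add: mult_ac)
  also have "q * (1 / q) = 1"
    using n0 by (simp add: q_def)
  finally have L: "A (n - 1) = of_real \<omega> * of_real q * exp (- (\<i> * th n)) * A n"
    unfolding w2 by (simp flip: exp_add)
  have Rt: "A (Suc n) = of_real \<omega> * A n * of_real r * exp (\<i> * th (Suc n))"
    using A_Suc[of n] assms by (simp add: r_def)
  have An: "A n \<noteq> 0"
    using assms by (intro A_nz) simp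
  have zz: "of_real \<omega> * w = - z"
    using w2 by (simp add: w_eq flip: mult.assoc)
  have R1: "R n = of_real (a (n - 1)) * (of_real \<omega> * of_real q * exp (- (\<i> * th n)))
       + (of_real (b n) - z) + of_real (a n) * (of_real \<omega> * of_real r * exp (\<i> * th (Suc n)))"
    unfolding R_def L Rt using An by (simp add: field_simps)
  have "real n powr \<sigma> * aL n = a (n - 1) * q" "real n powr \<sigma> * aR n = a n * r"
    unfolding aL_def aR_def q_def[symmetric] r_def[symmetric] using n0 by simp_all
  then have s1: "complex_of_real (real n powr \<sigma>) * of_real (aL n) = of_real (a (n - 1)) * of_real q"
    and s2: "complex_of_real (real n powr \<sigma>) * of_real (aR n) = of_real (a n) * of_real r"
    by (simp_all only: of_real_mult[symmetric])
  have s3: "complex_of_real (real n powr \<sigma>) * of_real (\<omega> * b n / real n powr \<sigma>) = of_real \<omega> * of_real (b n)"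
    unfolding of_real_mult[symmetric] using n0 by simp
  have s4: "complex_of_real (real n powr \<sigma>) * of_real (real n powr (- \<sigma>)) = 1"
    using n0 by (simp add: powr_minus flip: of_real_mult)
  have "of_real (\<omega> * real n powr \<sigma>) *
     (of_real (aL n) * exp (- (\<i> * th n)) + of_real (\<omega> * b n / real n powr \<sigma>)
      + w * of_real (real n powr (- \<sigma>)) + of_real (aR n) * exp (\<i> * th (Suc n)))
     = of_real \<omega> * ((of_real (real n powr \<sigma>) * of_real (aL n)) * exp (- (\<i> * th n))
         + of_real (real n powr \<sigma>) * of_real (\<omega> * b n / real n powr \<sigma>)
         + w * (of_real (real n powr \<sigma>) * of_real (real n powr (- \<sigma>)))
         + (of_real (real n powr \<sigma>) * of_real (aR n)) * exp (\<i> * th (Suc n)))"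
    by (simp only: of_real_mult ring_distribs mult_ac)
  also have "\<dots> = of_real (a (n - 1)) * (of_real \<omega> * of_real q * exp (- (\<i> * th n)))
       + ((of_real \<omega> * of_real \<omega>) * of_real (b n) + of_real \<omega> * w) + of_real (a n) * (of_real \<omega> * of_real r * exp (\<i> * th (Suc n)))"
    unfolding s1 s2 s3 s4 by (simp only: ring_distribs mult_ac add_ac mult_1)
  also have "\<dots> = R n"
    unfolding R1 zz w2 by simp
  finally show ?thesis ..
qed

lemma aR_expansion: "(\<lambda>n. aR n - (1 + (\<alpha> - \<sigma> / 2 + 1 / 4) / real n)) \<in> O(\<lambda>n. real n powr (-2))"
proof -
  define r where "r n = real (Suc n) powr (- rho \<sigma>) / real n powr (- rho \<sigma>)" for n
  have 1: "r \<in> O(\<lambda>_. 1)"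
    unfolding r_def rho_eq by real_asymp
  have 2: "(\<lambda>n. (1 + \<alpha> / real n) * r n - (1 + (\<alpha> - \<sigma> / 2 + 1 / 4) / real n)) \<in> O(\<lambda>n. 1 / real n ^ 2)"
    unfolding r_def rho_eq by real_asymp
  have "(\<lambda>n. (a n / real n powr \<sigma> - (1 + \<alpha> / real n)) * r n
      + ((1 + \<alpha> / real n) * r n - (1 + (\<alpha> - \<sigma> / 2 + 1 / 4) / real n))) \<in> O(\<lambda>n. 1 / real n ^ 2)"
    using landau_o.big.mult[OF a_expansion 1] 2 by (intro sum_in_bigo(1)) simp_all
  also have "(\<lambda>n. (a n / real n powr \<sigma> - (1 + \<alpha> / real n)) * r n
      + ((1 + \<alpha> / real n) * r n - (1 + (\<alpha> - \<sigma> / 2 + 1 / 4) / real n)))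
     = (\<lambda>n. aR n - (1 + (\<alpha> - \<sigma> / 2 + 1 / 4) / real n))"
    unfolding aR_def r_def[symmetric] by (simp only: telescope)
  also have "(\<lambda>n. 1 / real n ^ 2) \<in> O(\<lambda>n. real n powr (-2))"
    by real_asymp
  finally show ?thesis .
qed

lemma aL_expansion: "(\<lambda>n. aL n - (1 + (\<alpha> - \<sigma> / 2 - 1 / 4) / real n)) \<in> O(\<lambda>n. real n powr (-2))"
proof -
  define r where "r n = (real n - 1) powr \<sigma> / real n powr \<sigma> *
     ((real n - 1) powr (- rho \<sigma>) / real n powr (- rho \<sigma>))" for n
  have 1: "r \<in> O(\<lambda>_. 1)"
    unfolding r_def rho_eq by real_asymp
  have 2: "(\<lambda>n. (1 + \<alpha> / (real n - 1)) * r n - (1 + (\<alpha> - \<sigma> / 2 - 1 / 4) / real n)) \<in> O(\<lambda>n. 1 / real n ^ 2)"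
    unfolding r_def rho_eq by real_asymp
  have "filterlim (\<lambda>n::nat. n - 1) sequentially sequentially"
    by (rule filterlim_minus_const_nat_at_top)
  from landau_o.big.compose[OF a_expansion this]
  have "(\<lambda>n. a (n - 1) / real (n - 1) powr \<sigma> - (1 + \<alpha> / real (n - 1))) \<in> O(\<lambda>n. 1 / real (n - 1) ^ 2)" .
  also have "(\<lambda>n. 1 / real (n - 1) ^ 2) \<in> O(\<lambda>n. 1 / real n ^ 2)"
  proof -
    have "(\<lambda>n. 1 / (real n - 1) ^ 2) \<in> O(\<lambda>n. 1 / real n ^ 2)"
      by real_asymp
    also have "?this \<longleftrightarrow> ?thesis"
      by (intro landau_o.big.in_cong eventually_sequentiallyI[of 1]) (simp add: of_nat_diff)
    finally show ?thesis .
  qed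
  finally have "(\<lambda>n. (a (n - 1) / real (n - 1) powr \<sigma> - (1 + \<alpha> / real (n - 1))) * r n
      + ((1 + \<alpha> / (real n - 1)) * r n - (1 + (\<alpha> - \<sigma> / 2 - 1 / 4) / real n))) \<in> O(\<lambda>n. 1 / real n ^ 2)"
    using 2 landau_o.big.mult[OF _ 1] by (intro sum_in_bigo(1)) fastforce+
  also have "?this \<longleftrightarrow> (\<lambda>n. aL n - (1 + (\<alpha> - \<sigma> / 2 - 1 / 4) / real n)) \<in> O(\<lambda>n. 1 / real n ^ 2)"
  proof (rule landau_o.big.in_cong)
    show "\<forall>\<^sub>F n in sequentially. (a (n - 1) / real (n - 1) powr \<sigma> - (1 + \<alpha> / real (n - 1))) * r n
      + ((1 + \<alpha> / (real n - 1)) * r n - (1 + (\<alpha> - \<sigma> / 2 - 1 / 4) / real n))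
      = aL n - (1 + (\<alpha> - \<sigma> / 2 - 1 / 4) / real n)"
      using eventually_ge_at_top[of 2]
    proof eventually_elim
      case (elim n)
      have n: "real (n - 1) = real n - 1"
        using elim by simp
      have "(real n - 1) powr \<sigma> \<noteq> 0"
        using elim by simp
      then have "a (n - 1) / real (n - 1) powr \<sigma> * r n = aL n"
        unfolding r_def aL_def n by simp
      then show ?case
        unfolding n telescope by simp
    qed
  qed
  also have "(\<lambda>n. 1 / real n ^ 2) \<in> O(\<lambda>n. real n powr (-2))"
    by real_asymp
  finally show ?thesis .
qed

lemma b_expansion': "(\<lambda>n. \<omega> * b n / real n powr \<sigma> + 2 * (1 + \<beta> / real n)) \<in> O(\<lambda>n. real n powr (-2))"
proof -
  have "(\<lambda>n. - 2 * (- \<omega> * b n / (2 * real n powr \<sigma>) - (1 + \<beta> / real n))) \<in> O(\<lambda>n. 1 / real n ^ 2)"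
    using b_expansion by (subst landau_o.big.cmult_in_iff) auto
  also have "(\<lambda>n. - 2 * (- \<omega> * b n / (2 * real n powr \<sigma>) - (1 + \<beta> / real n)))
      = (\<lambda>n. \<omega> * b n / real n powr \<sigma> + 2 * (1 + \<beta> / real n))"
    by (rule ext) (simp add: ring_distribs)
  also have "(\<lambda>n. 1 / real n ^ 2) \<in> O(\<lambda>n. real n powr (-2))"
    by real_asymp
  finally show ?thesis .
qed

text \<open>With \<open>h = 1 / n\<close>, \<open>c1\<close> and \<open>c2\<close> the coefficients of \<open>h\<close> in \<open>aL\<close> and \<open>aR\<close>, the terms cancel order by order.
  At order \<open>h\<close>, the exponentials give \<open>2 - th\<^sup>2\<close>, and \<open>th\<^sup>2 = - \<tau> h + w n powr (- \<sigma>)\<close> offsets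
  \<open>c1 + c2 - 2 \<beta> = - \<tau>\<close>. At order \<open>h powr (3 / 2)\<close>, the term \<open>(c2 - c1) \<i> th h\<close> with \<open>c2 - c1 = 1 / 2\<close>
  offsets the drift \<open>- \<i> th h / 2\<close> of the exponent from \<open>n\<close> to \<open>n + 1\<close>: this is what fixes \<open>\<rho>\<close>.\<close>

lemma residual_bigo:
  "(\<lambda>n. of_real (aL n) * exp (- (\<i> * th n)) + of_real (\<omega> * b n / real n powr \<sigma>)
      + w * of_real (real n powr (- \<sigma>)) + of_real (aR n) * exp (\<i> * th (Suc n))) \<in> O(pw (- \<sigma> - 1/2))"
proof -
  define s where "s = - \<sigma> - 1/2"
  have s: "-2 \<le> s" "s \<le> -3/2"
    using \<sigma> by (auto simp: s_def)
  define c1 c2 :: complex where "c1 = of_real (\<alpha> - \<sigma> / 2 - 1 / 4)" and "c2 = of_real (\<alpha> - \<sigma> / 2 + 1 / 4)"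
  define h where "h n = 1 / complex_of_nat n" for n
  define em ep es where "em n = exp (- (\<i> * th n))" and "ep n = exp (\<i> * th n)"
    and "es n = exp (\<i> * th (Suc n))" for n
  define e1 e2 e3 where "e1 n = complex_of_real (aL n - (1 + (\<alpha> - \<sigma> / 2 - 1 / 4) / real n))"
    and "e2 n = complex_of_real (aR n - (1 + (\<alpha> - \<sigma> / 2 + 1 / 4) / real n))"
    and "e3 n = complex_of_real (\<omega> * b n / real n powr \<sigma> + 2 * (1 + \<beta> / real n))" for n
  have e1: "e1 \<in> O(pw s)" and e2: "e2 \<in> O(pw s)" and e3: "e3 \<in> O(pw s)"
    unfolding e1_def e2_def e3_def
    by (rule pw_mono[OF pw_of_real s(1)], rule aL_expansion aR_expansion b_expansion')+
  have h: "h \<in> O(pw (-1))"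
    unfolding h_def by (rule inverse_n_bigo)
  have em1: "(\<lambda>n. em n - 1 + \<i> * th n) \<in> O(pw (-1))"
    using exp_pw[OF i_th_bigo(2), of 1] by (simp add: em_def algebra_simps)
  have ep1: "(\<lambda>n. ep n - 1 - \<i> * th n) \<in> O(pw (-1))"
    using exp_pw[OF i_th_bigo(1), of 1] by (simp add: ep_def algebra_simps)
  have step: "(\<lambda>n. es n - ep n + \<i> * th n * h n / 2) \<in> O(pw s)"
    using exp_th_step by (simp add: es_def ep_def s_def h_def mult.commute)
  have thh: "(\<lambda>n. \<i> * th n * h n) \<in> O(pw (-1))"
    using pw_mult[OF i_th_bigo(1) h] by (rule pw_mono) simp
  have thh2: "(\<lambda>n. 1/2 * (\<i> * th n * h n)) \<in> O(pw (-1))"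
    using thh by (subst landau_o.big.cmult_in_iff) auto
  have es1: "(\<lambda>n. es n - 1 - \<i> * th n) \<in> O(pw (-1))"
  proof -
    have "(\<lambda>n. (es n - ep n + \<i> * th n * h n / 2) - 1/2 * (\<i> * th n * h n) + (ep n - 1 - \<i> * th n)) \<in> O(pw (-1))"
      by (rule pw_add[OF pw_diff[OF pw_mono[OF step] thh2] ep1]) (use s in simp)
    then show ?thesis by (simp add: algebra_simps)
  qed
  have bem: "em \<in> O(pw 0)"
    unfolding em_def
    by (rule pw_bounded, rule tendsto_exp, rule tendsto_minus, rule tendsto_mult[OF tendsto_const th_tendsto])
  have bes: "es \<in> O(pw 0)"
    unfolding es_def
    by (rule pw_bounded, rule tendsto_exp, rule tendsto_mult[OF tendsto_const LIMSEQ_Suc[OF th_tendsto]])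
  have s1: "(\<lambda>n. em n + ep n - 2 + th n ^ 2) \<in> O(pw s)"
    unfolding em_def ep_def by (rule pw_mono[OF exp_th_sum s(1)])
  have s2: "(\<lambda>n. c1 * (h n * (em n - 1 + \<i> * th n))) \<in> O(pw s)"
    by (rule pw_mono[OF pw_mult[OF pw_const pw_mult[OF h em1]]]) (use s in simp)
  have s3: "(\<lambda>n. c2 * (h n * (es n - 1 - \<i> * th n))) \<in> O(pw s)"
    by (rule pw_mono[OF pw_mult[OF pw_const pw_mult[OF h es1]]]) (use s in simp)
  have s4: "(\<lambda>n. e1 n * em n) \<in> O(pw s)"
    using pw_mult[OF e1 bem] by simp
  have s5: "(\<lambda>n. e2 n * es n) \<in> O(pw s)"
    using pw_mult[OF e2 bes] by simp
  have "(\<lambda>n. (em n + ep n - 2 + th n ^ 2) + (es n - ep n + \<i> * th n * h n / 2)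
      + c1 * (h n * (em n - 1 + \<i> * th n)) + c2 * (h n * (es n - 1 - \<i> * th n))
      + e1 n * em n + e2 n * es n + e3 n) \<in> O(pw s)"
    by (rule pw_add[OF pw_add[OF pw_add[OF pw_add[OF pw_add[OF pw_add[OF s1 step] s2] s3] s4] s5] e3])
  moreover have "(em n + ep n - 2 + th n ^ 2) + (es n - ep n + \<i> * th n * h n / 2)
      + c1 * (h n * (em n - 1 + \<i> * th n)) + c2 * (h n * (es n - 1 - \<i> * th n))
      + e1 n * em n + e2 n * es n + e3 n
    = of_real (aL n) * exp (- (\<i> * th n)) + of_real (\<omega> * b n / real n powr \<sigma>)
      + w * of_real (real n powr (- \<sigma>)) + of_real (aR n) * exp (\<i> * th (Suc n))" for n
  proof -
    have aL: "of_real (aL n) = 1 + c1 * h n + e1 n"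
      by (simp add: c1_def h_def e1_def)
    have aR: "of_real (aR n) = 1 + c2 * h n + e2 n"
      by (simp add: c2_def h_def e2_def)
    have bb: "of_real (\<omega> * b n / real n powr \<sigma>) = e3 n - 2 * (1 + of_real \<beta> * h n)"
      by (simp add: h_def e3_def)
    have ww: "w * of_real (real n powr (- \<sigma>)) = th n ^ 2 + of_real \<tau> * h n"
      by (simp add: th_sq tt_def h_def)
    have c: "c2 = c1 + 1 / 2" "of_real \<tau> = 2 * of_real \<beta> - c1 - c2"
      by (simp_all add: c1_def c2_def \<tau>_eq)
    show ?thesis
      unfolding aL aR bb ww c em_def[symmetric] es_def[symmetric]
      by (simp add: field_simps)
  qed
  ultimately show ?thesis
    by (simp only: s_def)
qed

lemma R_bigo: "R \<in> O(pw (- 1/2))"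
proof -
  define T where "T n = of_real (aL n) * exp (- (\<i> * th n)) + of_real (\<omega> * b n / real n powr \<sigma>)
      + w * of_real (real n powr (- \<sigma>)) + of_real (aR n) * exp (\<i> * th (Suc n))" for n
  have "(\<lambda>n. \<omega> * real n powr \<sigma>) \<in> O(\<lambda>n. real n powr \<sigma>)"
    using \<omega>_nz by simp
  from pw_mult[OF pw_of_real[OF this] residual_bigo]
  have "(\<lambda>n. of_real (\<omega> * real n powr \<sigma>) * T n) \<in> O(pw (-1/2))"
    unfolding T_def by (rule pw_mono) simp
  also have "?this \<longleftrightarrow> ?thesis"
    unfolding T_def
    by (intro landau_o.big.in_cong eventually_sequentiallyI[of "max 2 N"]) (subst R_eq, auto)
  finally show ?thesis .
qed

text \<open>A discrete Wronskian of \<open>A\<close> and \<open>f\<close>: it equals \<open>a n * (A n * f (Suc n) - A (Suc n) * f n)\<close>. Since \<open>f\<close> solves the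
  equation and \<open>A\<close> nearly does, its increments are small.\<close>

definition D :: "nat \<Rightarrow> complex" where
  "D n = of_real (a n) * (A n * A (Suc n)) * (u (Suc n) - u n)"

lemma D_increment:
  assumes "n \<ge> 1"
  shows "D (Suc n) - D n = - (A (Suc n) ^ 2 * R (Suc n) * u (Suc n))"
proof -
  have f: "f k = A k * u k" if "k \<ge> 1" for k
    using A_nz[OF that] by (simp add: u_def)
  have "of_real (a n) * f n + of_real (b (Suc n)) * f (Suc n) + of_real (a (Suc n)) * f (Suc (Suc n)) = z * f (Suc n)"
    using solution[unfolded jacobi_solution_def, rule_format, of "Suc n"] by simp
  then have eq: "of_real (a n) * A n * u n + (of_real (b (Suc n)) - z) * A (Suc n) * u (Suc n)
      + of_real (a (Suc n)) * A (Suc (Suc n)) * u (Suc (Suc n)) = 0"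
    using assms by (simp add: f algebra_simps)
  define V where "V = of_real (a n) * A n + (of_real (b (Suc n)) - z) * A (Suc n) + of_real (a (Suc n)) * A (Suc (Suc n))"
  have 1: "A (Suc n) ^ 2 * R (Suc n) * u (Suc n) = A (Suc n) * u (Suc n) * V"
    using A_nz[of "Suc n"] by (simp add: R_def V_def power2_eq_square)
  have "D (Suc n) - D n = A (Suc n) * ((of_real (a n) * A n * u n + (of_real (b (Suc n)) - z) * A (Suc n) * u (Suc n)
      + of_real (a (Suc n)) * A (Suc (Suc n)) * u (Suc (Suc n))) - u (Suc n) * V)"
    by (simp add: D_def V_def algebra_simps)
  then show ?thesis
    unfolding eq 1 by (simp add: mult_ac)
qed

lemma norm_A_sq: "cmod (A n) ^ 2 = real n powr (1/2 - \<sigma>) / M n"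
proof -
  have w1: "\<bar>\<omega>\<bar> = 1"
    using sign by (metis abs_mult_self_eq abs_one abs_square_eq_1 power2_eq_square)
  have "cmod (A n) = real n powr (- rho \<sigma>) * exp (- Im (\<Phi> n))"
    by (simp add: A_def norm_mult norm_power w1)
  also have "\<dots> ^ 2 = (real n powr (- rho \<sigma>)) ^ 2 * exp (- Im (\<Phi> n)) ^ 2"
    by (simp only: power_mult_distrib)
  also have "(real n powr (- rho \<sigma>)) ^ 2 = real n powr (1 / 2 - \<sigma>)"
    by (simp add: power2_eq_square rho_eq flip: powr_add)
  also have "exp (- Im (\<Phi> n)) ^ 2 = 1 / M n"
    by (simp add: M_def power2_eq_square exp_minus divide_inverse flip: exp_add exp_minus)
  finally show ?thesis by simp
qed

lemma D_eq:
  assumes "n \<ge> N"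
  shows "D n = of_real (\<omega> * Q n) * exp (\<i> * th (Suc n)) / E n * (u (Suc n) - u n)"
  using a_A_A[OF assms] by (simp add: D_def)

text \<open>The factor \<open>1 / M n\<close> beats the growth \<open>n powr (1 / 2)\<close> of \<open>Q\<close>, while \<open>u\<close> stays bounded.\<close>

lemma D_tendsto_0: "D \<longlonglongrightarrow> 0"
proof -
  (* The powers of n and n + 1 cancel; they are inserted so that Q and 1 / M n appear in the scaled forms
     whose limits are known. *)
  have "(\<lambda>n. inverse (real n powr (-(1/2)) * M n)) \<longlonglongrightarrow> 0"
    by (rule tendsto_inverse_0_at_top) (rule growth)
  moreover have "(\<lambda>n. real (Suc n) powr (1/2) * real n powr (-(1/2))) \<longlonglongrightarrow> 1"
    by real_asymp
  ultimately have "(\<lambda>n. \<bar>\<omega>\<bar> * \<bar>Q n * real (Suc n) powr (- (1/2))\<bar> * (real (Suc n) powr (1/2) * real n powr (-(1/2)))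
      * inverse (real n powr (-(1/2)) * M n) * cmod (exp (\<i> * th (Suc n)) * (u (Suc n) - u n)))
     \<longlonglongrightarrow> \<bar>\<omega>\<bar> * \<bar>1\<bar> * 1 * 0 * cmod (exp (\<i> * 0) * (1 - 1))"
    by (intro tendsto_intros Q_scaled \<theta>_Suc_tendsto_0 u_tendsto LIMSEQ_Suc[OF u_tendsto])
  then have "(\<lambda>n. \<bar>\<omega>\<bar> * \<bar>Q n * real (Suc n) powr (- (1/2))\<bar> * (real (Suc n) powr (1/2) * real n powr (-(1/2)))
      * inverse (real n powr (-(1/2)) * M n) * cmod (exp (\<i> * th (Suc n)) * (u (Suc n) - u n))) \<longlonglongrightarrow> 0"
    by simp
  moreover have "\<forall>\<^sub>F n in sequentially. \<bar>\<omega>\<bar> * \<bar>Q n * real (Suc n) powr (- (1/2))\<bar> * (real (Suc n) powr (1/2) * real n powr (-(1/2)))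
      * inverse (real n powr (-(1/2)) * M n) * cmod (exp (\<i> * th (Suc n)) * (u (Suc n) - u n)) = cmod (D n)"
    using ev_N
  proof eventually_elim
    case (elim n)
    have "real (Suc n) powr (- (1/2)) * real (Suc n) powr (1/2) = 1"
      by (simp flip: powr_add)
    moreover have "real n powr (-(1/2)) * inverse (real n powr (-(1/2))) = 1"
      using elim by simp
    moreover have "\<bar>\<omega>\<bar> * \<bar>Q n * real (Suc n) powr (- (1/2))\<bar> * (real (Suc n) powr (1/2) * real n powr (-(1/2)))
      * inverse (real n powr (-(1/2)) * M n) * cmod (exp (\<i> * th (Suc n)) * (u (Suc n) - u n))
      = \<bar>\<omega>\<bar> * \<bar>Q n\<bar> * (real (Suc n) powr (- (1/2)) * real (Suc n) powr (1/2))
        * (real n powr (-(1/2)) * inverse (real n powr (-(1/2)))) * inverse (M n) * cmod (exp (\<i> * th (Suc n)) * (u (Suc n) - u n))"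
      by (simp only: abs_mult abs_of_nonneg[OF powr_ge_zero] inverse_mult_distrib mult_ac)
    moreover have "cmod (D n) = \<bar>\<omega>\<bar> * \<bar>Q n\<bar> * inverse (M n) * cmod (exp (\<i> * th (Suc n)) * (u (Suc n) - u n))"
      using elim by (subst D_eq) (simp_all only: norm_mult norm_inverse norm_of_real norm_E abs_mult divide_inverse mult_ac)
    ultimately show ?case
      by (simp only: mult_1_right)
  qed
  ultimately have "(\<lambda>n. cmod (D n)) \<longlonglongrightarrow> 0"
    by (rule Lim_transform_eventually)
  then show ?thesis
    by (simp add: tendsto_norm_zero_iff)
qed

text \<open>The increments of \<open>D\<close> are at most of size \<open>n powr (- \<sigma>) / M n\<close>. This is dominated by the decrements of
  \<open>X n\<close>, a multiple of \<open>n powr (- 1 / 2) / M n\<close>, because \<open>1 / M n\<close> falls by at least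
  \<open>2 * Im (th (n + 1)) / M (n + 1)\<close>, and \<open>Im (th n)\<close> is at least a multiple of \<open>n powr (1 / 2 - \<sigma>)\<close>. Merely
  bounding \<open>1 / M m\<close> by \<open>1 / M n\<close> for \<open>m \<ge> n\<close> and summing \<open>m powr (- \<sigma>)\<close> would give the weaker
  \<open>n powr (1 - \<sigma>) / M n\<close>.\<close>

lemma D_bound: "(\<lambda>n. D n * E n) \<in> O(pw (-1/2))"
proof -
  have "(\<lambda>n. R n * u n) \<in> O(pw (-1/2))"
    using pw_mult[OF R_bigo pw_bounded[OF u_tendsto]] by simp
  from landau_o.bigE[OF pw_norm[OF this]]
  obtain C where C: "C > 0" "\<forall>\<^sub>F n in sequentially. cmod (R n * u n) \<le> C * real n powr (-1/2)"
    by auto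
  obtain B where B: "B > 0" "\<forall>\<^sub>F n in sequentially. norm (real n powr (1/2 - \<sigma>)) \<le> B * norm (Im (th n))"
    using landau_o.bigE[OF Im_th_lower] by blast
  define X where "X n = C * B / 2 * (real n powr (-1/2) / M n)" for n
  have "\<forall>\<^sub>F n in sequentially. cmod (D (Suc n) - D n) \<le> X n - X (Suc n)"
    using eventually_compose_filterlim[OF C(2) filterlim_Suc]
      eventually_compose_filterlim[OF B(2) filterlim_Suc] ev_N
  proof eventually_elim
    case (elim n)
    let ?m = "Suc n"
    have ImB: "real ?m powr (1/2 - \<sigma>) \<le> B * Im (th ?m)"
      using elim(2) Im_th_pos[of ?m] by simp
    have Mm: "1 / M n = exp (2 * Im (th ?m)) * (1 / M ?m)"
      using elim by (simp add: M_Suc)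
    have "2 * Im (th ?m) \<le> exp (2 * Im (th ?m)) - 1"
      using exp_ge_add_one_self[of "2 * Im (th ?m)"] by linarith
    then have "2 * Im (th ?m) * (1 / M ?m) \<le> (exp (2 * Im (th ?m)) - 1) * (1 / M ?m)"
      by (rule mult_right_mono) (simp add: less_imp_le)
    also have "\<dots> = 1 / M n - 1 / M ?m"
      unfolding Mm by (simp add: diff_divide_distrib)
    finally have gap: "2 * Im (th ?m) * (1 / M ?m) \<le> 1 / M n - 1 / M ?m" .
    have "cmod (D ?m - D n) = cmod (A ?m) ^ 2 * cmod (R ?m * u ?m)"
      using elim by (simp add: D_increment norm_mult norm_power)
    also have "\<dots> = real ?m powr (1/2 - \<sigma>) * (1 / M ?m) * cmod (R ?m * u ?m)"
      by (simp only: norm_A_sq) simp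
    also have "\<dots> \<le> (B * Im (th ?m)) * (1 / M ?m) * (C * real ?m powr (-1/2))"
      using elim(1) ImB B(1) Im_th_pos[of ?m]
      by (intro mult_mono) (auto simp: less_imp_le)
    also have "\<dots> = C * B / 2 * real ?m powr (-1/2) * (2 * Im (th ?m) * (1 / M ?m))"
      by simp
    also have "\<dots> \<le> C * B / 2 * real ?m powr (-1/2) * (1 / M n - 1 / M ?m)"
      using B(1) C(1) by (intro mult_left_mono gap) simp
    also have "\<dots> = C * B / 2 * (real ?m powr (-1/2) * (1 / M n)) - X ?m"
      by (simp add: X_def right_diff_distrib)
    also have "\<dots> \<le> C * B / 2 * (real n powr (-1/2) * (1 / M n)) - X ?m"
      using B(1) C(1) elim(3)
      by (intro diff_right_mono mult_left_mono mult_right_mono powr_mono2') (auto simp: less_imp_le)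
    also have "\<dots> = X n - X ?m"
      by (simp add: X_def)
    finally show ?case .
  qed
  then obtain k where k: "\<And>n. n \<ge> k \<Longrightarrow> cmod (D (Suc n) - D n) \<le> X n - X (Suc n)"
    by (auto simp: eventually_sequentially)
  have "(\<lambda>n. real n powr (-1/2)) \<longlonglongrightarrow> 0"
    by real_asymp
  then have "(\<lambda>n. C * B / 2 * (real n powr (-1/2) * inverse (M n))) \<longlonglongrightarrow> C * B / 2 * (0 * 0)"
    by (intro tendsto_intros tendsto_inverse_0_at_top M_at_top)
  then have X0: "X \<longlonglongrightarrow> 0"
    unfolding X_def[abs_def] by (simp only: divide_inverse mult_zero_left mult_zero_right)
  show ?thesis
  proof (rule bigoI[of _ "C * B / 2"], rule eventually_sequentiallyI[of k])
    fix n assume "k \<le> n"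
    with norm_le_of_increments[OF D_tendsto_0 X0] k have "cmod (D n) \<le> X n"
      by blast
    then show "cmod (D n * E n) \<le> C * B / 2 * cmod (pw (-1/2) n)"
      by (simp add: norm_mult norm_E X_def field_simps)
  qed
qed

lemma u_increment: "(\<lambda>n. u (Suc n) - u n) \<in> O(pw (-1))"
proof -
  define q where "q n = Q n * real (Suc n) powr (- (1/2))" for n
  have q: "q \<longlonglongrightarrow> 1"
    unfolding q_def by (rule Q_scaled)
  have "(\<lambda>n. complex_of_real \<omega> * exp (- (\<i> * th (Suc n))) / of_real (q n)) \<longlonglongrightarrow> of_real \<omega> * exp (- (\<i> * 0)) / of_real 1"
    by (intro tendsto_intros q \<theta>_Suc_tendsto_0) simp
  note 1 = pw_bounded[OF this]
  have 2: "(\<lambda>n. pw (-(1/2)) (Suc n)) \<in> O(pw (-(1/2)))"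
    by (rule pw_Suc) simp
  have "(\<lambda>n. D n * E n * (complex_of_real \<omega> * exp (- (\<i> * th (Suc n))) / of_real (q n)) * pw (-(1/2)) (Suc n)) \<in> O(pw (-1))"
    using pw_mult[OF pw_mult[OF D_bound 1] 2] by (rule pw_mono) simp
  also have "?this \<longleftrightarrow> ?thesis"
  proof (rule landau_o.big.in_cong)
    have "\<forall>\<^sub>F n in sequentially. q n \<noteq> 0"
      by (rule tendsto_imp_eventually_ne[OF q]) simp
    then show "\<forall>\<^sub>F n in sequentially. D n * E n * (complex_of_real \<omega> * exp (- (\<i> * th (Suc n))) / of_real (q n)) * pw (-(1/2)) (Suc n)
       = u (Suc n) - u n"
      using ev_N
    proof eventually_elim
      case (elim n)
      have Q: "Q n \<noteq> 0"
        using elim by (auto simp: q_def)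
      have "D n * E n = of_real (\<omega> * Q n) * exp (\<i> * th (Suc n)) * (u (Suc n) - u n)"
        using elim by (simp add: D_eq)
      then have "D n * E n * (complex_of_real \<omega> * exp (- (\<i> * th (Suc n))) / of_real (q n)) * pw (-(1/2)) (Suc n)
         = of_real (\<omega> * \<omega> * (Q n * real (Suc n) powr (-(1/2)) / q n)) * (exp (\<i> * th (Suc n)) * exp (- (\<i> * th (Suc n)))) * (u (Suc n) - u n)"
        by (simp only: of_real_mult of_real_divide of_real_inverse divide_inverse mult_ac)
      also have "Q n * real (Suc n) powr (-(1/2)) / q n = 1"
        unfolding q_def[symmetric] using elim by simp
      finally show ?case
        by (simp add: sign exp_minus)
    qed
  qed
  finally show ?thesis .
qed

text \<open>The sequence differs from \<open>K (Suc n)\<close> by \<open>O(1 / n)\<close>, and \<open>K\<close> itself varies by \<open>O(n powr (- \<sigma>))\<close>.\<close>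

lemma Q_sin_increment:
  "(\<lambda>n. of_real (Q (Suc n)) * sin (th (Suc (Suc n))) - of_real (Q n) * sin (th (Suc n))) \<in> O(pw (-1))"
proof -
  define q where "q n = Q n * real (Suc n) powr (- (1/2))" for n
  define v where "v n = pw (1/2) (Suc n) * (sin (th (Suc n)) - th (Suc n))" for n
  define s where "s n = of_real (Q n) * sin (th (Suc n))" for n
  have q: "q \<longlonglongrightarrow> 1"
    unfolding q_def by (rule Q_scaled)
  have q1: "(\<lambda>n. complex_of_real (q n - 1)) \<in> O(pw (-1))"
  proof -
    define r where "r n = real n powr \<sigma> * (real n * (real n + 1)) powr (- rho \<sigma>) * real (Suc n) powr (- (1/2))" for n
    have 1: "r \<in> O(\<lambda>_. 1)"
      unfolding r_def rho_eq by real_asymp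
    have 2: "(\<lambda>n. (1 + \<alpha> / real n) * r n - 1) \<in> O(\<lambda>n. real n powr (-1))"
      unfolding r_def rho_eq by real_asymp
    have 3: "(\<lambda>n. 1 / real n ^ 2) \<in> O(\<lambda>n. real n powr (-1))"
      by real_asymp
    have 4: "(\<lambda>n. (a n / real n powr \<sigma> - (1 + \<alpha> / real n)) * r n) \<in> O(\<lambda>n. real n powr (-1) * 1)"
      by (rule landau_o.big.mult[OF landau_o.big_trans[OF a_expansion 3] 1])
    have "(\<lambda>n. (a n / real n powr \<sigma> - (1 + \<alpha> / real n)) * r n + ((1 + \<alpha> / real n) * r n - 1)) \<in> O(\<lambda>n. real n powr (-1))"
      using 4 2 by (intro sum_in_bigo(1)) (simp_all only: mult_1_right)
    also have "?this \<longleftrightarrow> (\<lambda>n. q n - 1) \<in> O(\<lambda>n. real n powr (-1))"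
    proof (rule landau_o.big.in_cong)
      show "\<forall>\<^sub>F n in sequentially. (a n / real n powr \<sigma> - (1 + \<alpha> / real n)) * r n + ((1 + \<alpha> / real n) * r n - 1) = q n - 1"
        using eventually_ge_at_top[of 1]
      proof eventually_elim
        case (elim n)
        have "a n / real n powr \<sigma> * r n = q n"
          using elim by (simp add: r_def q_def Q_def)
        then show ?case
          unfolding telescope by simp
      qed
    qed
    finally show ?thesis
      by (rule pw_of_real)
  qed
  have "(\<lambda>n. pw (1/2) n * (sin (th n) - th n)) \<in> O(pw (1/2 + (-3/2)))"
    by (rule pw_mult[OF _ sin_th]) simp
  then have v: "v \<in> O(pw (-1))"
    unfolding v_def by (intro pw_Suc[of "\<lambda>n. pw (1/2) n * (sin (th n) - th n)"]) simp
  have "(\<lambda>n. of_real (q n) * v n + of_real (q n - 1) * K (Suc n)) \<in> O(pw (-1))"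
    using pw_mult[OF pw_bounded[OF tendsto_of_real[OF q]] v] pw_mult[OF q1 pw_bounded[OF LIMSEQ_Suc[OF K_tendsto]]]
    by (intro pw_add) (simp_all only: add_0_left add_0_right)
  also have "(\<lambda>n. of_real (q n) * v n + of_real (q n - 1) * K (Suc n)) = (\<lambda>n. s n - K (Suc n))"
  proof
    fix n
    have "of_real (q n) * pw (1/2) (Suc n) = of_real (Q n * (real (Suc n) powr (-(1/2)) * real (Suc n) powr (1/2)))"
      by (simp only: q_def of_real_mult mult_ac)
    also have "real (Suc n) powr (-(1/2)) * real (Suc n) powr (1/2) = 1"
      by (simp flip: powr_add)
    finally have "of_real (q n) * pw (1/2) (Suc n) = of_real (Q n)"
      by simp
    then have "s n = of_real (q n) * (pw (1/2) (Suc n) * sin (th (Suc n)))"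
      by (simp only: s_def mult.assoc[symmetric])
    moreover have "v n = pw (1/2) (Suc n) * sin (th (Suc n)) - K (Suc n)"
      by (simp only: v_def K_def right_diff_distrib)
    ultimately show "of_real (q n) * v n + of_real (q n - 1) * K (Suc n) = s n - K (Suc n)"
      by (simp only: of_real_diff of_real_1 right_diff_distrib left_diff_distrib mult_1) simp
  qed
  finally have sK: "(\<lambda>n. s n - K (Suc n)) \<in> O(pw (-1))" .
  have "(\<lambda>n. K (Suc n) - K n) \<in> O(pw (-1))"
    by (rule pw_mono[OF K_increment]) (use \<sigma> in simp)
  from pw_add[OF pw_diff[OF pw_Suc[OF sK] sK] pw_Suc[OF this]]
  show ?thesis
    by (simp add: s_def)
qed

lemma Y_increment: "(\<lambda>n. Y (Suc n) - Y n) \<in> O(pw (-1))"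
proof -
  define s where "s n = of_real (Q n) * sin (th (Suc n))" for n
  define W where "W n = s n * (u n * u (Suc n))" for n
  have s: "s \<longlonglongrightarrow> \<kappa>\<^sub>0" "(\<lambda>n. s (Suc n) - s n) \<in> O(pw (-1))"
    unfolding s_def by (rule Q_sin_tendsto, rule Q_sin_increment)
  have uu: "(\<lambda>n. u n * u (Suc n)) \<longlonglongrightarrow> 1 * 1"
    by (intro tendsto_intros u_tendsto LIMSEQ_Suc[OF u_tendsto])
  have duu: "(\<lambda>n. u (Suc n) * u (Suc (Suc n)) - u n * u (Suc n)) \<in> O(pw (-1))"
    by (rule slow_mult[OF u_tendsto LIMSEQ_Suc[OF u_tendsto] u_increment pw_Suc[OF u_increment]])
  have dW: "(\<lambda>n. W (Suc n) - W n) \<in> O(pw (-1))"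
    unfolding W_def by (rule slow_mult[OF s(1) uu s(2) duu])
  have W: "W \<longlonglongrightarrow> \<kappa>\<^sub>0"
    unfolding W_def using tendsto_mult[OF s(1) uu] by simp
  have "(\<lambda>n. - (of_real \<omega> * \<i> / 2) / (W n * W (Suc n))) \<longlonglongrightarrow> - (of_real \<omega> * \<i> / 2) / (\<kappa>\<^sub>0 * \<kappa>\<^sub>0)"
    by (intro tendsto_intros W LIMSEQ_Suc[OF W]) (use \<kappa>\<^sub>0_nz in auto)
  from pw_mult[OF pw_bounded[OF this] dW]
  have "(\<lambda>n. - (of_real \<omega> * \<i> / 2) / (W n * W (Suc n)) * (W (Suc n) - W n)) \<in> O(pw (-1))"
    by simp
  also have "?this \<longleftrightarrow> ?thesis"
  proof (rule landau_o.big.in_cong)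
    have "\<forall>\<^sub>F n in sequentially. W n \<noteq> 0"
      by (rule tendsto_imp_eventually_ne[OF W \<kappa>\<^sub>0_nz])
    moreover have "\<forall>\<^sub>F n in sequentially. W (Suc n) \<noteq> 0"
      by (rule tendsto_imp_eventually_ne[OF LIMSEQ_Suc[OF W] \<kappa>\<^sub>0_nz])
    ultimately show "\<forall>\<^sub>F n in sequentially. - (of_real \<omega> * \<i> / 2) / (W n * W (Suc n)) * (W (Suc n) - W n) = Y (Suc n) - Y n"
    proof eventually_elim
      case (elim n)
      have "Y n = of_real \<omega> * \<i> / 2 / W n" for n
        by (simp add: Y_def W_def s_def)
      with elim show ?case
        by (simp add: field_simps)
    qed
  qed
  finally show ?thesis .
qed

text \<open>Here \<open>\<sigma> < 3 / 2\<close> is decisive: it makes \<open>1 / n\<close> small against \<open>Im (th n)\<close>.\<close>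

lemma sum_asymp_oscillating: "(\<lambda>n. (\<Sum>m=n0..n. summand m) / E n) \<longlonglongrightarrow> c"
proof (rule sum_asymp_slow)
  have "(\<lambda>n. cmod (Y (Suc n) - Y n)) \<in> O(\<lambda>n. real n powr (-1))"
    by (rule pw_norm[OF Y_increment])
  also have "(\<lambda>n. real n powr (-1)) \<in> o(\<lambda>n. real (Suc n) powr (1/2 - \<sigma>))"
    using \<sigma> by real_asymp
  also have "(\<lambda>n. real (Suc n) powr (1/2 - \<sigma>)) \<in> O(\<lambda>n. Im (th (Suc n)))"
    by (rule landau_o.big.compose[OF Im_th_lower filterlim_Suc])
  finally show "(\<lambda>n. cmod (Y (Suc n) - Y n)) \<in> o(\<lambda>n. Im (th (Suc n)))" .
qed

end

section \<open>The sector case and the conclusion\<close>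

lemma sector_bounds:
  fixes \<theta> :: "nat \<Rightarrow> complex"
  assumes lim: "(\<lambda>n. of_real (real n powr \<nu>) * \<theta> n) \<longlonglongrightarrow> \<kappa>" and Im_\<kappa>: "Im \<kappa> > 0" and \<nu>: "\<nu> < 1"
  shows "\<theta> \<in> O(\<lambda>n. of_real (Im (\<theta> n)))"
    and "filterlim (\<lambda>n. real n * Im (\<theta> n)) at_top sequentially"
proof -
  have Im_lim: "(\<lambda>n. real n powr \<nu> * Im (\<theta> n)) \<longlonglongrightarrow> Im \<kappa>"
    using tendsto_Im[OF lim] by simp
  have "\<forall>\<^sub>F n in sequentially. real n powr \<nu> * Im (\<theta> n) > 0"
    using order_tendstoD(1)[OF Im_lim Im_\<kappa>] .
  then have Im_nz: "\<forall>\<^sub>F n in sequentially. real n powr \<nu> \<noteq> 0 \<and> Im (\<theta> n) \<noteq> 0"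
    by eventually_elim (metis less_irrefl mult_zero_left mult_zero_right)
  have "(\<lambda>n. (of_real (real n powr \<nu>) * \<theta> n) / of_real (real n powr \<nu> * Im (\<theta> n))) \<longlonglongrightarrow> \<kappa> / of_real (Im \<kappa>)"
    by (intro tendsto_divide lim tendsto_of_real Im_lim) (use Im_\<kappa> in auto)
  moreover have "\<forall>\<^sub>F n in sequentially. (of_real (real n powr \<nu>) * \<theta> n) / of_real (real n powr \<nu> * Im (\<theta> n))
      = \<theta> n / of_real (Im (\<theta> n))"
    using Im_nz by eventually_elim simp
  ultimately have "(\<lambda>n. \<theta> n / of_real (Im (\<theta> n))) \<longlonglongrightarrow> \<kappa> / of_real (Im \<kappa>)"
    by (rule Lim_transform_eventually)
  then show "\<theta> \<in> O(\<lambda>n. of_real (Im (\<theta> n)))"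
    by (rule bigoI_tendsto) (use Im_nz in eventually_elim, auto)
  have "filterlim (\<lambda>n. real n powr (1 - \<nu>)) at_top sequentially"
    using \<nu> by real_asymp
  from filterlim_tendsto_pos_mult_at_top[OF Im_lim Im_\<kappa> this]
  have "filterlim (\<lambda>n. real n powr \<nu> * Im (\<theta> n) * real n powr (1 - \<nu>)) at_top sequentially" .
  moreover have "\<forall>\<^sub>F n in sequentially. real n powr \<nu> * Im (\<theta> n) * real n powr (1 - \<nu>) = real n * Im (\<theta> n)"
    using eventually_ge_at_top[of 1]
  proof eventually_elim
    case (elim n)
    have "real n powr \<nu> * real n powr (1 - \<nu>) = real n"
      using elim by (simp flip: powr_add)
    then show ?case
      by (metis mult.assoc mult.commute)
  qed
  from filterlim_cong[OF refl refl this]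
  have "filterlim (\<lambda>n. real n powr \<nu> * Im (\<theta> n) * real n powr (1 - \<nu>)) at_top sequentially
    \<longleftrightarrow> filterlim (\<lambda>n. real n * Im (\<theta> n)) at_top sequentially" .
  ultimately show "filterlim (\<lambda>n. real n * Im (\<theta> n)) at_top sequentially"
    by blast
qed

text \<open>For \<open>\<sigma> < 1\<close> the term \<open>w n powr (- \<sigma>)\<close> dominates \<open>\<tau> / n\<close>, and the terms with \<open>l \<ge> 2\<close> are of higher order in
  a sequence that tends to zero.\<close>

lemma TT_asymp:
  assumes "0 < \<sigma>" "\<sigma> < 1"
  shows "(\<lambda>n. of_real (real n powr \<sigma>) * TT \<sigma> \<tau> L p n w) \<longlonglongrightarrow> w"
proof -
  define t where "t n = tt \<sigma> \<tau> n w" for n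
  have "(\<lambda>n. real n powr \<sigma> * (\<tau> / real n)) \<longlonglongrightarrow> 0" "(\<lambda>n. \<tau> / real n) \<longlonglongrightarrow> 0"
    "(\<lambda>n. real n powr (-\<sigma>)) \<longlonglongrightarrow> 0" "(\<lambda>n. real n powr \<sigma> * real n powr (-\<sigma>)) \<longlonglongrightarrow> 1"
    using assms by real_asymp+
  note lims = this[THEN tendsto_of_real[where 'a = complex]]
  have "(\<lambda>n. - of_real (\<tau> / real n) + w * of_real (real n powr (-\<sigma>))) \<longlonglongrightarrow> - of_real 0 + w * of_real 0"
    by (intro tendsto_intros lims)
  then have t0: "t \<longlonglongrightarrow> 0"
    by (simp add: t_def[abs_def] tt_def)
  have "(\<lambda>n. - of_real (real n powr \<sigma> * (\<tau> / real n)) + w * of_real (real n powr \<sigma> * real n powr (-\<sigma>)))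
     \<longlonglongrightarrow> - of_real 0 + w * of_real 1"
    by (intro tendsto_intros lims)
  then have t1: "(\<lambda>n. of_real (real n powr \<sigma>) * t n) \<longlonglongrightarrow> w"
    by (simp add: t_def tt_def algebra_simps)
  have "(\<lambda>n. of_real (real n powr \<sigma>) * t n * (1 + (\<Sum>l=2..L. of_real (p l) * t n ^ (l - 1))))
     \<longlonglongrightarrow> w * (1 + (\<Sum>l=2..L. of_real (p l) * 0 ^ (l - 1)))"
    by (intro tendsto_intros t0 t1)
  moreover have "(\<Sum>l=2..L. of_real (p l) * 0 ^ (l - 1)) = (0 :: complex)"
    by (intro sum.neutral) auto
  moreover have "of_real (real n powr \<sigma>) * t n * (1 + (\<Sum>l=2..L. of_real (p l) * t n ^ (l - 1)))
      = of_real (real n powr \<sigma>) * TT \<sigma> \<tau> L p n w" for n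
  proof -
    have "t n * (\<Sum>l=2..L. of_real (p l) * t n ^ (l - 1)) = (\<Sum>l=2..L. of_real (p l) * t n ^ l)"
      unfolding sum_distrib_left
    proof (rule sum.cong)
      fix l assume "l \<in> {2..L}"
      then have "l = Suc (l - 1)" by simp
      then have "t n ^ l = t n * t n ^ (l - 1)" by (metis power_Suc)
      then show "t n * (of_real (p l) * t n ^ (l - 1)) = of_real (p l) * t n ^ l" by simp
    qed simp
    then show ?thesis
      by (simp add: TT_def t_def ring_distribs mult.assoc)
  qed
  ultimately show ?thesis
    by (simp only: add_0_right mult_1_right)
qed

lemma theta_asymp_sector:
  assumes "\<sigma> > 1 \<and> \<tau> > 0 \<or> 0 < \<sigma> \<and> \<sigma> < 1 \<and> w \<notin> \<real>\<^sub>\<ge>\<^sub>0 \<or> \<sigma> = 1 \<and> w - of_real \<tau> \<notin> \<real>\<^sub>\<ge>\<^sub>0"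
  shows "(\<lambda>n. of_real (real n powr (if \<sigma> \<ge> 1 then 1/2 else \<sigma>/2)) * theta \<sigma> \<tau> L p n w) \<longlonglongrightarrow> varkappa \<sigma> \<tau> w"
    and "Im (varkappa \<sigma> \<tau> w) > 0"
proof -
  consider "\<sigma> > 1" "\<tau> > 0" | "0 < \<sigma>" "\<sigma> < 1" "w \<notin> \<real>\<^sub>\<ge>\<^sub>0" | "\<sigma> = 1" "w - of_real \<tau> \<notin> \<real>\<^sub>\<ge>\<^sub>0"
    using assms by blast
  then have "(\<lambda>n. of_real (real n powr (if \<sigma> \<ge> 1 then 1/2 else \<sigma>/2)) * theta \<sigma> \<tau> L p n w) \<longlonglongrightarrow> varkappa \<sigma> \<tau> w
      \<and> Im (varkappa \<sigma> \<tau> w) > 0"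
  proof cases
    case 1
    have \<kappa>: "varkappa \<sigma> \<tau> w = bsqrt (- of_real \<tau>)"
      using 1 by (simp add: varkappa_def bsqrt_def csqrt_of_real_nonneg)
    have neg: "- complex_of_real \<tau> \<notin> \<real>\<^sub>\<ge>\<^sub>0"
      using 1 by (simp add: complex_nonneg_Reals_iff)
    have "(\<lambda>n. real n powr (1 - \<sigma>)) \<longlonglongrightarrow> 0"
      using 1 by real_asymp
    then have "(\<lambda>n. - of_real \<tau> + w * of_real (real n powr (1 - \<sigma>))) \<longlonglongrightarrow> - of_real \<tau> + w * of_real 0"
      by (intro tendsto_intros)
    then have "(\<lambda>n. - of_real \<tau> + w * of_real (real n powr (1 - \<sigma>))) \<longlonglongrightarrow> - of_real \<tau>"
      by simp
    moreover have "\<forall>\<^sub>F n in sequentially. - of_real \<tau> + w * of_real (real n powr (1 - \<sigma>))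
        = of_real (real n powr (2 * (1/2))) * tt \<sigma> \<tau> n w"
      using eventually_ge_at_top[of 1]
    proof eventually_elim
      case (elim n)
      have "real n powr (1 - \<sigma>) = real n * real n powr (-\<sigma>)"
        using elim powr_add[of "real n" 1 "-\<sigma>"] by simp
      then show ?case
        using elim by (simp add: tt_def algebra_simps)
    qed
    ultimately have "(\<lambda>n. of_real (real n powr (2 * (1/2))) * tt \<sigma> \<tau> n w) \<longlonglongrightarrow> - of_real \<tau>"
      by (rule Lim_transform_eventually)
    from bsqrt_decay[OF this neg] Im_bsqrt_pos[OF neg] show ?thesis
      using 1 by (simp add: \<kappa> theta_def theta_arg_def)
  next
    case 2
    have "(\<lambda>n. of_real (real n powr (2 * (\<sigma>/2))) * TT \<sigma> \<tau> L p n w) \<longlonglongrightarrow> w"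
      using TT_asymp[OF 2(1,2)] by simp
    from bsqrt_decay[OF this 2(3)] Im_bsqrt_pos[OF 2(3)] show ?thesis
      using 2 by (simp add: varkappa_def theta_def theta_arg_def)
  next
    case 3
    have "\<forall>\<^sub>F n in sequentially. varkappa \<sigma> \<tau> w
        = of_real (real n powr (if \<sigma> \<ge> 1 then 1/2 else \<sigma>/2)) * theta \<sigma> \<tau> L p n w"
      using eventually_ge_at_top[of 1]
    proof eventually_elim
      case (elim n)
      have "complex_of_real (real n powr (1/2)) * of_real (real n powr (-1/2)) = 1"
        using elim by (simp flip: powr_add of_real_mult)
      then have "complex_of_real (real n powr (1/2)) * (bsqrt (w - of_real \<tau>) * of_real (real n powr (-1/2))) = bsqrt (w - of_real \<tau>)"
        by (metis mult.commute mult.left_commute mult.right_neutral)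
      then show ?case
        using 3(1) by (simp add: varkappa_def theta_def theta_arg_def)
    qed
    with Im_bsqrt_pos[OF 3(2)] 3(1) show ?thesis
      using Lim_transform_eventually[OF tendsto_const] by (simp add: varkappa_def)
  qed
  then show "(\<lambda>n. of_real (real n powr (if \<sigma> \<ge> 1 then 1/2 else \<sigma>/2)) * theta \<sigma> \<tau> L p n w) \<longlonglongrightarrow> varkappa \<sigma> \<tau> w"
    and "Im (varkappa \<sigma> \<tau> w) > 0"
    by blast+
qed

theorem theorem2p7:
  fixes \<gamma> \<sigma> \<alpha> \<beta> \<tau> :: real
    and a b p :: "nat \<Rightarrow> real"
    and L N n\<^sub>0 :: nat
    and z :: complex
    and f g :: "nat \<Rightarrow> complex"
  assumes "\<gamma> \<in> {1, -1}" and "0 < \<sigma>" and "\<sigma> \<le> 3 / 2"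
    and "\<And>n. a n > 0"
    and "(\<lambda>n. a n / real n powr \<sigma> - (1 + \<alpha> / real n)) \<in> O(\<lambda>n. 1 / real n ^ 2)"
    and "(\<lambda>n. b n / (2 * \<gamma> * real n powr \<sigma>) - (1 + \<beta> / real n)) \<in> O(\<lambda>n. 1 / real n ^ 2)"
    and "\<tau> = 2 * \<beta> - 2 * \<alpha> + \<sigma>"
    and "\<sigma> > 1 \<and> (\<tau> < 0 \<and> \<sigma> < 3 / 2 \<and> Im z \<noteq> 0 \<or> \<tau> > 0)
       \<or> \<sigma> < 1 \<and> (\<gamma> = 1 \<and> z \<notin> of_real ` {0..} \<or> \<gamma> = -1 \<and> z \<notin> of_real ` {..0})
       \<or> \<sigma> = 1 \<and> (\<gamma> = 1 \<and> z \<notin> of_real ` {\<tau>..} \<or> \<gamma> = -1 \<and> z \<notin> of_real ` {..- \<tau>})"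
    and "\<sigma> < 1 \<Longrightarrow> L \<ge> 1 \<and> (real L + 1 / 2) * \<sigma> > 1 \<and> corr_coeffs L p"
    and "N \<ge> 1" and "\<And>m. m \<ge> N \<Longrightarrow> theta_arg \<sigma> \<tau> L p m (of_real \<gamma> * z) \<notin> \<real>\<^sub>\<ge>\<^sub>0"
    and "jacobi_solution a b z f"
    and "f \<sim>[sequentially] (\<lambda>n. (- of_real \<gamma>) ^ n * of_real (real n powr (- rho \<sigma>))
           * exp (\<i> * phase \<sigma> \<tau> L p N n (of_real \<gamma> * z)))"
    and "n\<^sub>0 \<ge> 1" and "\<And>n. n \<ge> n\<^sub>0 - 1 \<Longrightarrow> f n \<noteq> 0"
    and "jacobi_solution a b z g"
    and "\<And>n. n \<ge> n\<^sub>0 \<Longrightarrow>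
           g n = f n * (\<Sum>m=n\<^sub>0..n. inverse (of_real (a (m - 1)) * f (m - 1) * f m))"
  shows "g \<sim>[sequentially] (\<lambda>n. \<i> / (2 * varkappa \<sigma> \<tau> (of_real \<gamma> * z))
           * (- of_real \<gamma>) ^ (n + 1) * of_real (real n powr (- rho \<sigma>))
           * exp (- \<i> * phase \<sigma> \<tau> L p N n (of_real \<gamma> * z)))
       \<and> (z \<notin> closure (spec_set \<gamma> \<sigma> \<tau>) \<longrightarrow> \<not> summable (\<lambda>n. (cmod (g n))\<^sup>2))"
proof -
  have \<gamma>: "\<gamma> * \<gamma> = 1" using assms(1) by auto
  have \<gamma>_cases: "\<gamma> = 1 \<or> \<gamma> = -1" using assms(1) by auto
  define w where "w = of_real \<gamma> * z"
  have a_ratio: "(\<lambda>n. a n * real n powr (- \<sigma>)) \<longlonglongrightarrow> 1"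
    using ratio_tendsto_1[OF assms(5)] by (simp only: powr_minus divide_inverse)
  have f_asymp: "f \<sim>[sequentially] (\<lambda>n. of_real (- \<gamma>) ^ n * of_real (real n powr (- rho \<sigma>))
           * exp (\<i> * (\<Sum>m=N..n. theta \<sigma> \<tau> L p m w)))"
    using assms(13) by (simp add: phase_def w_def)
  have g_eq: "g n = f n * (\<Sum>m=n\<^sub>0..n. inverse (of_real (a (m - 1)) * f (m - 1) * f m))" if "n \<ge> n\<^sub>0" for n
    using assms(17) that .
  have conclusion: ?thesis
    if "g \<sim>[sequentially] (\<lambda>n. of_real (- \<gamma>) * \<i> / (2 * varkappa \<sigma> \<tau> w) * of_real (- \<gamma>) ^ n
          * of_real (real n powr (- rho \<sigma>)) * exp (- \<i> * phase \<sigma> \<tau> L p N n w))"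
      and "\<not> summable (\<lambda>n. (cmod (g n))\<^sup>2)"
    using that by (simp add: w_def mult_ac)
  (* This is the case in which varkappa is real; in all others it lies in the open upper half plane. *)
  show ?thesis
  proof (cases "\<sigma> > 1 \<and> \<tau> < 0")
    case True
    then have Im_z: "Im z \<noteq> 0" and \<sigma>: "1 < \<sigma>" "\<sigma> < 3/2"
      using assms(8) by auto
    interpret oscillating \<sigma> \<tau> w
      using True \<sigma> Im_z \<gamma>_cases by unfold_locales (auto simp: w_def)
    have th: "theta \<sigma> \<tau> L p n w = th n" for n
      using \<sigma> by (simp add: theta_def theta_arg_def th_def)
    interpret oscillating_jacobi \<sigma> \<tau> w "- \<gamma>" \<alpha> \<beta> a b z N f
    proof unfold_locales
      show "(\<lambda>n. - (- \<gamma>) * b n / (2 * real n powr \<sigma>) - (1 + \<beta> / real n)) \<in> O(\<lambda>n. 1 / real n ^ 2)"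
        using assms(6) \<gamma>_cases by auto
      show "f \<sim>[sequentially] (\<lambda>n. of_real (- \<gamma>) ^ n * of_real (real n powr (- rho \<sigma>))
           * exp (\<i> * (\<Sum>m=N..n. th m)))"
        using f_asymp by (simp add: th)
    qed (use \<gamma> assms(4,5,7,12) in \<open>auto simp: w_def\<close>)
    have \<kappa>: "\<kappa>\<^sub>0 = varkappa \<sigma> \<tau> w"
      using True by (simp add: \<kappa>\<^sub>0_def varkappa_def)
    have \<Phi>: "\<Phi> n = phase \<sigma> \<tau> L p N n w" for n
      by (simp add: \<Phi>_def phase_def th)
    have g_summand: "g n = f n * (\<Sum>m=n\<^sub>0..n. summand m)" if "n \<ge> n\<^sub>0" for n
      using g_eq[OF that] by (simp only: summand_def)
    note sol = second_solution[OF sum_asymp_oscillating, of _ g, unfolded c_def, unfolded \<kappa> \<Phi>]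
    show ?thesis
      by (rule conclusion[OF sol]) (erule g_summand)+
  next
    case False
    define \<nu> where "\<nu> = (if \<sigma> \<ge> 1 then 1/2 else \<sigma>/2)"
    have sector: "\<sigma> > 1 \<and> \<tau> > 0 \<or> 0 < \<sigma> \<and> \<sigma> < 1 \<and> w \<notin> \<real>\<^sub>\<ge>\<^sub>0 \<or> \<sigma> = 1 \<and> w - of_real \<tau> \<notin> \<real>\<^sub>\<ge>\<^sub>0"
    proof -
      have "w \<notin> \<real>\<^sub>\<ge>\<^sub>0" if "\<sigma> < 1"
      proof
        assume "w \<in> \<real>\<^sub>\<ge>\<^sub>0"
        then obtain r where r: "r \<ge> 0" "w = of_real r"
          by (auto simp: nonneg_Reals_def)
        have "z = of_real \<gamma> * w"
          using \<gamma> by (simp add: w_def flip: mult.assoc of_real_mult)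
        then have "z = of_real (\<gamma> * r)"
          using r by simp
        with r(1) that assms(8) show False
          by auto
      qed
      moreover have "w - of_real \<tau> \<notin> \<real>\<^sub>\<ge>\<^sub>0" if "\<sigma> = 1"
        using that assms(11)[of N] by (simp add: theta_arg_def w_def)
      ultimately show ?thesis
        using False assms(2,8) by (cases \<sigma> "1::real" rule: linorder_cases) auto
    qed
    note lim = theta_asymp_sector(1)[OF sector, of L p, folded \<nu>_def]
    note Im_\<kappa> = theta_asymp_sector(2)[OF sector]
    have \<nu>: "0 < \<nu>" "\<nu> < 1" "2 * rho \<sigma> + \<nu> = \<sigma>"
      using assms(2) by (auto simp: \<nu>_def rho_def)
    interpret wkb "- \<gamma>" "rho \<sigma>" \<nu> a "\<lambda>n. theta \<sigma> \<tau> L p n w" "varkappa \<sigma> \<tau> w" N f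
    proof unfold_locales
      show "varkappa \<sigma> \<tau> w \<noteq> 0"
        using Im_\<kappa> by auto
      show "filterlim (\<lambda>n. real n * Im (theta \<sigma> \<tau> L p n w)) at_top sequentially"
        by (rule sector_bounds(2)[OF lim Im_\<kappa> \<nu>(2)])
    qed (use \<gamma> assms(4) a_ratio lim \<nu> f_asymp in simp_all)
    have \<Phi>: "\<Phi> n = phase \<sigma> \<tau> L p N n w" for n
      by (simp add: \<Phi>_def phase_def)
    have g_summand: "g n = f n * (\<Sum>m=n\<^sub>0..n. summand m)" if "n \<ge> n\<^sub>0" for n
      using g_eq[OF that] by (simp only: summand_def)
    note sol = second_solution[OF sum_asymp_sector[OF sector_bounds(1)[OF lim Im_\<kappa> \<nu>(2)]], of _ g,
        unfolded c_def \<Phi>]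
    show ?thesis
      by (rule conclusion[OF sol]) (erule g_summand)+
  qed
qed

end
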